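(* Let $\mu,\nu\in\mathbb{R}$ with $\mu\in(-\frac32,-\frac12)$ and $|\nu|\in(|\mu+1|,\mu+2)$. Then the entire function $z\mapsto {}_1F_2\left(1;\frac{\mu-\nu+3}{2},\frac{\mu+\nu+3}{2};z\right)$ possesses only real negative zeros. The zeros are simple and are contained in the intervals $\left(-\frac{(2k+3)^2\pi^2}{16},-\frac{(2k+1)^2\pi^2}{16}\right)$, $k=0,1,2,\ldots$, each interval containing exactly one zero.
   Context: ${}_1F_2(a;b,c;z)=\sum_{n\ge0}\frac{(a)_n}{(b)_n(c)_n}\frac{z^n}{n!}$ is the generalized hypergeometric function, with $(x)_n$ the Pochhammer symbol. *)

theory Defs
  imports "HOL-Complex_Analysis.Complex_Analysis"
begin

definition hypergeometric_1F2 :: "complex \<Rightarrow> complex \<Rightarrow> complex \<Rightarrow> complex \<Rightarrow> complex" where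
  "hypergeometric_1F2 a b c z = eval_fps (fps_hypergeo [a] [b, c] 1) z"

lemma hypergeometric_1F2_series:
  "hypergeometric_1F2 a b c z =
     (\<Sum>n. pochhammer a n / (pochhammer b n * pochhammer c n) * (z ^ n / fact n))"
  by (simp add: hypergeometric_1F2_def eval_fps_def)

end

theory Submission
  imports Defs
begin

text \<open>
  The lower parameters \<open>b\<close> and \<open>c\<close> satisfy, after exchanging them if \<open>\<nu> < 0\<close>,
  \<open>1/2 < b < 1 < c < 2\<close> and \<open>b + c < 5/2\<close>. Write \<open>F\<close> for the function of the theorem and put
  \<open>E z = F (- z\<^sup>2 / 4)\<close>, so that the claim says that the zeros of \<open>E\<close> are real, simple and separated by
  the zeros \<open>x\<^sub>k = (k + 1/2) \<pi>\<close> of the cosine. This is Polya's situation of a cosine transform of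
  an increasing function.

  The coefficients of \<open>E\<close> are those of \<open>cos\<close> multiplied by
  \<open>(1/2)\<^sub>n (1)\<^sub>n / ((b)\<^sub>n (c)\<^sub>n)\<close>, the \<open>n\<close>-th moment of a product of two independent
  Beta variables. Hence \<open>E z\<close> is, up to a constant, the integral over \<open>0 < s < 1\<close> of
  \<open>phi s * s powr (-1/2) * cos (z * sqrt s)\<close> for an explicit positive \<open>phi\<close>
  (\<open>nn_integral_moment\<close>, \<open>F_cosine_transform\<close>). Two consequences matter. The integrand is dominated by
  \<open>exp \<bar>Im z\<bar>\<close>, so \<open>E / cos\<close> stays bounded on the circles of radius \<open>N \<pi>\<close>. And \<open>phi\<close> is increasing
  (\<open>phi_mono\<close>), so by the second mean value theorem the last arch of the cosine decides the sign and
  \<open>(-1)^k * E x\<^sub>k > 0\<close> (\<open>F_alternates_at_cos_nodes\<close>).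

  The residue theorem turns the boundedness into the expansion of \<open>E z / cos z\<close> in partial fractions
  with poles at the \<open>x\<^sub>k\<close> (\<open>partial_fractions\<close>), and the alternating signs make all its coefficients
  positive. As a function of \<open>w = z\<^sup>2\<close>, the quotient therefore maps the upper half-plane into itself and is
  strictly increasing between consecutive poles \<open>x\<^sub>k\<^sup>2\<close>. So it has no nonreal zero, at most one zero in each
  gap, and that zero is simple; the change of sign of \<open>E\<close> supplies its existence. Below \<open>x\<^sub>0\<^sup>2\<close> there is no
  zero because \<open>F\<close> is positive on the nonnegative reals and all terms of the expansion are positive for
  \<open>0 < w < x\<^sub>0\<^sup>2\<close>.
\<close>

section \<open>Residues at simple zeros and the size of the cosine\<close>

text \<open>
  In contrast to \<open>residue_simple_pole_deriv\<close>, the numerator may vanish at \<open>z\<close>. This matters because the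
  expansion below is applied precisely at points where the function under study may be zero.
\<close>

lemma residue_div_simple_zero:
  assumes "open S" "z \<in> S" and f: "f holomorphic_on S" and g: "g holomorphic_on S"
    and nz: "\<And>w. w \<in> S \<Longrightarrow> w \<noteq> z \<Longrightarrow> g w \<noteq> 0"
    and g0: "g z = 0" and der: "(g has_field_derivative g') (at z)" and "g' \<noteq> 0"
  shows "residue (\<lambda>w. f w / g w) z = f z / g'"
proof (rule residue_simple'[OF assms(1,2)])
  show "(\<lambda>w. f w / g w) holomorphic_on (S - {z})"
    using nz by (intro holomorphic_intros holomorphic_on_subset[OF f] holomorphic_on_subset[OF g]) auto
  have "((\<lambda>w. (g w - g z) / (w - z)) \<longlongrightarrow> g') (at z)"
    using der by (simp add: has_field_derivative_iff)
  moreover have "(f \<longlongrightarrow> f z) (at z)"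
    using f assms(1,2) continuous_on_eq_continuous_at holomorphic_on_imp_continuous_on isCont_def by blast
  ultimately have "((\<lambda>w. f w / ((g w - g z) / (w - z))) \<longlongrightarrow> f z / g') (at z)"
    using \<open>g' \<noteq> 0\<close> by (intro tendsto_intros)
  then show "((\<lambda>w. f w / g w * (w - z)) \<longlongrightarrow> f z / g') (at z)"
    by (simp add: g0)
qed

text \<open>
  The circle \<open>norm z = N \<pi>\<close> crosses the real axis where \<open>\<bar>cos\<bar> = 1\<close>. Away from the axis the hyperbolic
  part \<open>sinh (Im z)\<close> dominates; within distance \<open>1\<close> of it the real part is so close to \<open>\<plusminus> N \<pi>\<close> that
  \<open>\<bar>cos (Re z)\<bar> \<ge> cos (\<pi>/3) = 1/2\<close>. The constant only has to exceed \<open>2 * exp 1\<close>.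
\<close>

lemma exp_abs_Im_le_norm_cos:
  assumes "norm z = real N * pi" "N > 0"
  shows "exp \<bar>Im z\<bar> \<le> 6 * norm (cos z)"
proof -
  define x y where "x = \<bar>Re z\<bar>" and "y = \<bar>Im z\<bar>"
  have xy: "x \<ge> 0" "y \<ge> 0" "x\<^sup>2 + y\<^sup>2 = (real N * pi)\<^sup>2"
    using assms cmod_power2[of z] by (auto simp: x_def y_def)
  have cosx: "cos x = cos (Re z)" by (simp add: x_def)
  have sq: "norm (cos z) ^ 2 = cos x ^ 2 + (exp y - exp (-y)) ^ 2 / 4"
  proof (cases "Im z \<ge> 0")
    case False
    then show ?thesis unfolding norm_cos_squared cosx
      by (simp add: y_def exp_minus power2_commute)
  qed (simp add: norm_cos_squared cosx y_def exp_minus)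
  show ?thesis unfolding y_def[symmetric]
  proof (cases "y \<ge> 1")
    case True
    have "2 \<le> exp y" using exp_ge_add_one_self[of y] True by linarith
    then have "exp (-y) \<le> 1/2" by (simp add: exp_minus field_simps)
    with \<open>2 \<le> exp y\<close> have "(exp y / 2) ^ 2 \<le> (exp y - exp (-y)) ^ 2"
      by (intro power_mono) auto
    also have "\<dots> \<le> 4 * norm (cos z) ^ 2" by (simp add: sq)
    also have "\<dots> = (2 * norm (cos z)) ^ 2" by (simp add: power2_eq_square)
    finally have "exp y / 2 \<le> 2 * norm (cos z)" by (rule power2_le_imp_le) simp
    then show "exp y \<le> 6 * norm (cos z)" using norm_ge_zero[of "cos z"] by linarith
  next
    case False
    define d where "d = real N * pi - x"
    have Npi: "real N * pi \<ge> 3" using assms(2) pi_gt3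
      by (smt (verit, best) One_nat_def Suc_leI mult_cancel_right1 mult_le_cancel_right_pos of_nat_1 of_nat_mono)
    have eq: "d * (real N * pi + x) = y\<^sup>2" using xy by (simp add: d_def algebra_simps power2_eq_square)
    have y1: "y\<^sup>2 \<le> 1" using False xy by (simp add: power_le_one)
    have d0: "d \<ge> 0" using eq Npi xy
      by (smt (verit, best) mult_neg_pos zero_le_power2)
    have "d * 3 \<le> d * (real N * pi + x)" using d0 Npi xy by (intro mult_left_mono) auto
    then have "d \<le> 1" using eq y1 by linarith
    then have "cos (pi/3) \<le> cos d" using d0 pi_gt3 by (intro cos_monotone_0_pi_le) auto
    moreover have "\<bar>cos x\<bar> = \<bar>cos d\<bar>"
    proof -
      have "cos x = cos (real N * pi - d)" by (simp add: d_def)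
      also have "\<dots> = (-1)^N * cos d" by (simp add: cos_diff)
      finally show ?thesis by (simp add: abs_mult)
    qed
    ultimately have "1/2 \<le> \<bar>cos x\<bar>" by (simp add: cos_60)
    then have "(1/2)\<^sup>2 \<le> \<bar>cos x\<bar>\<^sup>2" by (intro power_mono) auto
    also have "\<dots> \<le> norm (cos z) ^ 2" by (simp add: sq)
    finally have "1/2 \<le> norm (cos z)" by (rule power2_le_imp_le) simp
    moreover have "exp y \<le> exp 1" using False by simp
    ultimately show "exp y \<le> 6 * norm (cos z)" using exp_le by linarith
  qed
qed

definition cos_node :: "nat \<Rightarrow> real" where
  "cos_node k = (real k + 1/2) * pi"

lemma cos_node_pos: "cos_node k > 0"
  by (simp add: cos_node_def)

lemma cos_cos_node [simp]: "cos (cos_node k) = 0"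
  by (simp add: cos_node_def distrib_right cos_add)

lemma sin_cos_node [simp]: "sin (cos_node k) = (-1) ^ k"
  by (simp add: cos_node_def distrib_right sin_add)

lemma cos_node_eq_iff [simp]: "cos_node j = cos_node k \<longleftrightarrow> j = k"
  by (simp add: cos_node_def)

lemma cos_eq_0_iff_cos_node:
  fixes z :: complex
  shows "cos z = 0 \<longleftrightarrow> (\<exists>k. z = of_real (cos_node k) \<or> z = - of_real (cos_node k))"
proof
  assume "cos z = 0"
  then obtain n :: int where n: "z = of_real (of_int n * pi) + of_real pi / 2"
    using cos_eq_0 by blast
  show "\<exists>k. z = of_real (cos_node k) \<or> z = - of_real (cos_node k)"
  proof (cases "n \<ge> 0")
    case True
    then have "z = of_real (cos_node (nat n))"
      by (simp add: n cos_node_def algebra_simps)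
    then show ?thesis by blast
  next
    case False
    then have "real (nat (- n - 1)) = - of_int n - 1" by simp
    then have "z = - of_real (cos_node (nat (- n - 1)))"
      unfolding cos_node_def by (simp add: n algebra_simps)
    then show ?thesis by blast
  qed
next
  assume "\<exists>k. z = of_real (cos_node k) \<or> z = - of_real (cos_node k)"
  moreover have "cos (of_real (cos_node k)) = (0::complex)" for k
    by (metis cos_of_real cos_cos_node of_real_0)
  ultimately show "cos z = 0" by auto
qed

section \<open>Partial fractions over the zeros of the cosine\<close>

text \<open>
  An even entire function of \<open>z\<close> of the growth of the cosine is encoded by the entire function \<open>H\<close>
  with value \<open>H (z\<^sup>2)\<close>: zeros and poles then live in the plane of \<open>w = z\<^sup>2\<close>, where each
  pair \<open>\<plusminus> x\<^sub>k\<close> becomes a single point.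
\<close>

locale cos_dominated =
  fixes H :: "complex \<Rightarrow> complex" and C :: real
  assumes holo: "H holomorphic_on UNIV"
    and dominated: "\<And>z. norm (H (z\<^sup>2)) \<le> C * exp \<bar>Im z\<bar>"
begin

lemma C_nonneg: "C \<ge> 0"
  using order_trans[OF norm_ge_zero dominated[of 0]] by simp

definition node_coeff :: "nat \<Rightarrow> complex" where
  "node_coeff k = 2 * (-1) ^ k * H ((of_real (cos_node k))\<^sup>2) / of_real (cos_node k)"

text \<open>
  The residue theorem for \<open>H (\<zeta>\<^sup>2) / (cos \<zeta> * \<zeta> * (\<zeta>\<^sup>2 - z\<^sup>2))\<close> on the circle of radius \<open>N \<pi>\<close>. The factor
  \<open>\<zeta>\<close> makes the integrand decay like \<open>\<zeta>\<close> to the power \<open>-3\<close>, since \<open>H (\<zeta>\<^sup>2) / cos \<zeta>\<close> is merely bounded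
  there; its price is the subtracted value \<open>H 0\<close>.
\<close>

lemma partial_fraction_remainder:
  fixes z :: complex
  assumes z: "z \<noteq> 0" "cos z \<noteq> 0" and N: "norm z < real N * pi" "N > 0"
  shows "norm ((H (z\<^sup>2) / cos z - H 0) / z\<^sup>2
                 - (\<Sum>k<N. node_coeff k / ((of_real (cos_node k))\<^sup>2 - z\<^sup>2)))
           \<le> 6 * C / ((real N * pi)\<^sup>2 - (norm z)\<^sup>2)"
proof -
  define R where "R = real N * pi"
  define D :: "complex \<Rightarrow> complex" where "D \<zeta> = cos \<zeta> * (\<zeta> * (\<zeta>\<^sup>2 - z\<^sup>2))" for \<zeta>
  define D' :: "complex \<Rightarrow> complex" where
    "D' \<zeta> = cos \<zeta> * (3 * \<zeta>\<^sup>2 - z\<^sup>2) - sin \<zeta> * (\<zeta> * (\<zeta>\<^sup>2 - z\<^sup>2))" for \<zeta>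
  define q where "q \<zeta> = H (\<zeta>\<^sup>2) / D \<zeta>" for \<zeta>
  define x :: "nat \<Rightarrow> complex" where "x k = of_real (cos_node k)" for k
  define P where "P = {0, z, -z} \<union> (x ` {..<N} \<union> (\<lambda>k. - x k) ` {..<N})"
  let ?S = "ball (0::complex) (R + 1)"
  have R: "R > norm z" "R > 0" using N by (auto simp: R_def)
  have cosx: "cos (x k) = 0" and sinx: "sin (x k) = (-1)^k" for k
    unfolding x_def by (metis cos_of_real cos_cos_node of_real_0)
      (metis sin_of_real sin_cos_node of_real_minus of_real_1 of_real_power)
  have normx: "norm (x k) = cos_node k" for k
    using cos_node_pos[of k] by (simp add: x_def)
  have xz: "(x k)\<^sup>2 \<noteq> z\<^sup>2" for k
    using cosx[of k] z(2) by (auto simp: power2_eq_iff)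
  have x0: "x k \<noteq> 0" for k using normx[of k] cos_node_pos[of k] by auto
  have xneg: "x j \<noteq> - x k" for j k
  proof
    assume "x j = - x k"
    then have "cos_node j = - cos_node k" unfolding x_def by (metis of_real_eq_iff of_real_minus)
    then show False using cos_node_pos[of k] cos_node_pos[of j] by simp
  qed
  have xinj: "x j = x k \<longleftrightarrow> j = k" for j k by (simp add: x_def)
  have xzz: "x k \<noteq> z" "x k \<noteq> -z" "- x k \<noteq> z" for k
    using xz[of k] by (auto simp: power2_eq_iff)
  have Pfin: "finite P" by (simp add: P_def)
  have Dzero: "p \<in> P" if "p \<in> ?S" "D p = 0" for p
  proof -
    have "cos p = 0 \<or> p = 0 \<or> p = z \<or> p = -z"
      using that by (auto simp: D_def power2_eq_iff)
    moreover have "p \<in> P" if c: "cos p = 0"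
    proof -
      obtain k where k: "p = x k \<or> p = - x k"
        using c cos_eq_0_iff_cos_node unfolding x_def by blast
      then have "cos_node k < R + 1" using \<open>p \<in> ?S\<close> normx[of k] by auto
      \<comment> \<open>The disc of radius \<open>R + 1\<close> still misses the next node, which is \<open>\<pi>/2\<close> beyond \<open>R\<close>.\<close>
      moreover have "R + 1 < cos_node N"
        unfolding R_def cos_node_def using pi_gt3 by (simp add: distrib_right)
      ultimately have "cos_node k < cos_node N" by linarith
      then have "k < N" by (simp add: cos_node_def)
      with k show ?thesis by (auto simp: P_def)
    qed
    ultimately show ?thesis by (auto simp: P_def)
  qed
  have P_in: "norm p < R" "D p = 0" if "p \<in> P" for p
  proof -
    have "cos_node k < R" if "k < N" for k
    proof -
      have "real k + 1/2 < real N" using that by linarith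
      then show ?thesis by (simp add: cos_node_def R_def)
    qed
    then show "norm p < R" using that R normx by (auto simp: P_def)
    show "D p = 0" using that cosx by (auto simp: P_def D_def)
  qed
  have Dhol: "D holomorphic_on A" for A unfolding D_def by (intro holomorphic_intros)
  have Hhol: "(\<lambda>\<zeta>. H (\<zeta>\<^sup>2)) holomorphic_on A" for A
  proof -
    have "(\<lambda>\<zeta>. \<zeta>\<^sup>2) holomorphic_on A" by (intro holomorphic_intros)
    from holomorphic_on_compose_gen[OF this holo] show ?thesis by (simp add: o_def)
  qed
  have Dder: "(D has_field_derivative D' p) (at p)" for p
    unfolding D_def D'_def
    by (auto intro!: derivative_eq_intros simp: power2_eq_square algebra_simps)
  have D'nz: "D' p \<noteq> 0" if "p \<in> P" for p
    using that z xz x0 unfolding P_def D'_def by (auto simp: cosx sinx)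
  have res: "residue q p = H (p\<^sup>2) / D' p" if p: "p \<in> P" for p
    unfolding q_def
  proof (rule residue_div_simple_zero[where S = "?S - (P - {p})"])
    show "open (?S - (P - {p}))" using Pfin by (intro open_Diff finite_imp_closed) auto
    show "p \<in> ?S - (P - {p})" using P_in(1)[OF p] by auto
    show "D w \<noteq> 0" if "w \<in> ?S - (P - {p})" "w \<noteq> p" for w using Dzero that by blast
  qed (use Dhol Hhol Dder D'nz P_in p in auto)
  have "contour_integral (circlepath 0 R) q =
          2 * pi * \<i> * (\<Sum>p\<in>P. winding_number (circlepath 0 R) p * residue q p)"
  proof (rule Residue_theorem[where S = ?S])
    show "q holomorphic_on ?S - P" unfolding q_def
      using Dzero by (intro holomorphic_on_divide Hhol Dhol) auto
    show "path_image (circlepath 0 R) \<subseteq> ?S - P" using R P_in(1) by fastforce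
    show "\<forall>w. w \<notin> ?S \<longrightarrow> winding_number (circlepath 0 R) w = 0"
    proof (intro allI impI)
      fix w assume "w \<notin> ?S"
      then show "winding_number (circlepath 0 R) w = 0"
        using R by (intro winding_number_zero_outside[of _ "cball 0 R"]) auto
    qed
  qed (use Pfin in auto)
  also have "(\<Sum>p\<in>P. winding_number (circlepath 0 R) p * residue q p) = (\<Sum>p\<in>P. H (p\<^sup>2) / D' p)"
    using P_in(1) by (intro sum.cong refl) (simp add: winding_number_circlepath res)
  also have "\<dots> = (\<Sum>p\<in>{0, z, -z}. H (p\<^sup>2) / D' p) +
                 ((\<Sum>p\<in>x ` {..<N}. H (p\<^sup>2) / D' p) + (\<Sum>p\<in>(\<lambda>k. - x k) ` {..<N}. H (p\<^sup>2) / D' p))"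
  proof -
    have "({0, z, -z} \<inter> (x ` {..<N} \<union> (\<lambda>k. - x k) ` {..<N})) = {}"
      using x0 xzz by force
    then have "(\<Sum>p\<in>P. H (p\<^sup>2) / D' p) = (\<Sum>p\<in>{0, z, -z}. H (p\<^sup>2) / D' p) +
                 (\<Sum>p\<in>x ` {..<N} \<union> (\<lambda>k. - x k) ` {..<N}. H (p\<^sup>2) / D' p)"
      unfolding P_def by (intro sum.union_disjoint) auto
    also have "x ` {..<N} \<inter> (\<lambda>k. - x k) ` {..<N} = {}" using xneg by auto
    then have "(\<Sum>p\<in>x ` {..<N} \<union> (\<lambda>k. - x k) ` {..<N}. H (p\<^sup>2) / D' p) =
        (\<Sum>p\<in>x ` {..<N}. H (p\<^sup>2) / D' p) + (\<Sum>p\<in>(\<lambda>k. - x k) ` {..<N}. H (p\<^sup>2) / D' p)"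
      by (intro sum.union_disjoint) auto
    finally show ?thesis .
  qed
  also have "(\<Sum>p\<in>{0, z, -z}. H (p\<^sup>2) / D' p) = (H (z\<^sup>2) / cos z - H 0) / z\<^sup>2"
    using z by (simp add: D'_def field_simps eq_neg_iff_add_eq_0 power2_eq_square)
  also have "(\<Sum>p\<in>x ` {..<N}. H (p\<^sup>2) / D' p) + (\<Sum>p\<in>(\<lambda>k. - x k) ` {..<N}. H (p\<^sup>2) / D' p)
               = - (\<Sum>k<N. node_coeff k / ((x k)\<^sup>2 - z\<^sup>2))"
  proof -
    have "(\<Sum>p\<in>x ` {..<N}. H (p\<^sup>2) / D' p) = (\<Sum>k<N. H ((x k)\<^sup>2) / D' (x k))"
      by (subst sum.reindex) (auto simp: inj_on_def xinj)
    moreover have "(\<Sum>p\<in>(\<lambda>k. - x k) ` {..<N}. H (p\<^sup>2) / D' p) = (\<Sum>k<N. H ((x k)\<^sup>2) / D' (x k))"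
      by (subst sum.reindex) (auto simp: inj_on_def xinj D'_def)
    moreover have "2 * (H ((x k)\<^sup>2) / D' (x k)) = - (node_coeff k / ((x k)\<^sup>2 - z\<^sup>2))" for k
    proof -
      have "(-1::complex) ^ k * (-1) ^ k = 1" by (simp flip: power_add)
      then show ?thesis using x0[of k] xz[of k]
        by (cases "even k") (simp_all add: D'_def cosx sinx node_coeff_def field_simps flip: x_def)
    qed
    ultimately show ?thesis
      by (simp only: mult_2[symmetric] sum_distrib_left sum_negf)
  qed
  finally have int: "contour_integral (circlepath 0 R) q = 2 * pi * \<i> *
      ((H (z\<^sup>2) / cos z - H 0) / z\<^sup>2 - (\<Sum>k<N. node_coeff k / ((x k)\<^sup>2 - z\<^sup>2)))" (is "_ = _ * ?T")
    by simp
  have bnd: "norm (contour_integral (circlepath 0 R) q) \<le> (6 * C / (R * (R\<^sup>2 - (norm z)\<^sup>2))) * (2 * pi * R)"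
  proof (rule has_contour_integral_bound_circlepath)
    have "q holomorphic_on - P \<inter> ?S" unfolding q_def
      using Dzero by (intro holomorphic_on_divide Hhol Dhol) auto
    then have "continuous_on (path_image (circlepath 0 R)) q"
      by (rule continuous_on_subset[OF holomorphic_on_imp_continuous_on])
         (use R P_in(1) in fastforce)
    then show "(q has_contour_integral contour_integral (circlepath 0 R) q) (circlepath 0 R)"
      by (intro has_contour_integral_integral contour_integrable_continuous_circlepath)
    have pos: "R\<^sup>2 - (norm z)\<^sup>2 > 0" using R by (simp add: power_strict_mono)
    then show "0 \<le> 6 * C / (R * (R\<^sup>2 - (norm z)\<^sup>2))" using R C_nonneg by simp
    fix \<zeta> :: complex assume "norm (\<zeta> - 0) = R"
    then have \<zeta>: "norm \<zeta> = R" by simp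
    have e: "exp \<bar>Im \<zeta>\<bar> \<le> 6 * norm (cos \<zeta>)"
      using exp_abs_Im_le_norm_cos[of \<zeta> N] \<zeta> N by (simp add: R_def)
    then have cpos: "norm (cos \<zeta>) > 0" using exp_gt_zero[of "\<bar>Im \<zeta>\<bar>"] by linarith
    have "norm (H (\<zeta>\<^sup>2)) \<le> C * (6 * norm (cos \<zeta>))"
      using dominated[of \<zeta>] mult_left_mono[OF e C_nonneg] by linarith
    moreover have "norm (cos \<zeta>) * (R * (R\<^sup>2 - (norm z)\<^sup>2)) \<le> norm (D \<zeta>)"
    proof -
      have "R\<^sup>2 - (norm z)\<^sup>2 \<le> norm (\<zeta>\<^sup>2 - z\<^sup>2)"
        using norm_triangle_ineq2[of "\<zeta>\<^sup>2" "z\<^sup>2"] \<zeta> by (simp add: norm_power)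
      then show ?thesis using R \<zeta> by (simp add: D_def norm_mult mult_left_mono)
    qed
    ultimately have "norm (q \<zeta>) \<le> C * (6 * norm (cos \<zeta>)) / (norm (cos \<zeta>) * (R * (R\<^sup>2 - (norm z)\<^sup>2)))"
      unfolding q_def norm_divide using cpos R pos C_nonneg by (intro frac_le) auto
    also have "\<dots> = 6 * C / (R * (R\<^sup>2 - (norm z)\<^sup>2))" using cpos by simp
    finally show "norm (q \<zeta>) \<le> 6 * C / (R * (R\<^sup>2 - (norm z)\<^sup>2))" .
  qed (use R in auto)
  have "norm ?T * (2 * pi) \<le> (6 * C / (R\<^sup>2 - (norm z)\<^sup>2)) * (2 * pi)"
  proof -
    have "norm (2 * pi * \<i> * ?T) = norm ?T * (2 * pi)" by (simp only: norm_mult) simp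
    moreover have "6 * C / (R * (R\<^sup>2 - (norm z)\<^sup>2)) * (2 * pi * R) = 6 * C / (R\<^sup>2 - (norm z)\<^sup>2) * (2 * pi)"
      using R by simp
    ultimately show ?thesis using bnd unfolding int by simp
  qed
  then have "norm ?T \<le> 6 * C / (R\<^sup>2 - (norm z)\<^sup>2)"
    by (rule mult_right_le_imp_le) simp
  then show ?thesis unfolding x_def R_def .
qed

lemma partial_fractions:
  fixes z :: complex
  assumes z: "z \<noteq> 0" "cos z \<noteq> 0"
  shows "(\<lambda>k. node_coeff k / ((of_real (cos_node k))\<^sup>2 - z\<^sup>2)) sums ((H (z\<^sup>2) / cos z - H 0) / z\<^sup>2)"
proof -
  let ?S = "\<lambda>N. \<Sum>k<N. node_coeff k / ((of_real (cos_node k))\<^sup>2 - z\<^sup>2)"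
  let ?T = "(H (z\<^sup>2) / cos z - H 0) / z\<^sup>2"
  have "(\<lambda>N. ?T - ?S N) \<longlonglongrightarrow> 0"
  proof (rule Lim_null_comparison)
    have "filterlim (\<lambda>N. real N * pi) at_top sequentially"
      using filterlim_tendsto_pos_mult_at_top[OF tendsto_const pi_gt_zero filterlim_real_sequentially]
      by (simp add: mult.commute)
    then have "eventually (\<lambda>N. norm z < real N * pi) sequentially"
      by (simp add: filterlim_at_top_dense)
    with eventually_gt_at_top[of 0]
    show "eventually (\<lambda>N. norm (?T - ?S N) \<le> 6 * C / ((real N * pi)\<^sup>2 - (norm z)\<^sup>2)) sequentially"
      by eventually_elim (rule partial_fraction_remainder[OF z])
    show "(\<lambda>N. 6 * C / ((real N * pi)\<^sup>2 - (norm z)\<^sup>2)) \<longlonglongrightarrow> 0"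
      by real_asymp
  qed
  then have "?S \<longlonglongrightarrow> ?T"
    using tendsto_diff[OF tendsto_const[of ?T]] by fastforce
  then show ?thesis by (simp add: sums_def)
qed

end

section \<open>Interlacing of zeros with the zeros of the cosine\<close>

lemma cos_node_sq_less_iff [simp]: "(cos_node j)\<^sup>2 < (cos_node k)\<^sup>2 \<longleftrightarrow> j < k"
proof -
  have "(cos_node j)\<^sup>2 < (cos_node k)\<^sup>2 \<longleftrightarrow> cos_node j < cos_node k"
    using cos_node_pos[of j] cos_node_pos[of k] by (auto simp flip: not_le)
  then show ?thesis by (simp add: cos_node_def)
qed

lemma cos_node_sq_le_iff [simp]: "(cos_node j)\<^sup>2 \<le> (cos_node k)\<^sup>2 \<longleftrightarrow> j \<le> k"
  using cos_node_sq_less_iff[of k j] by linarith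

lemma sums_pos:
  fixes f :: "nat \<Rightarrow> real"
  assumes "f sums s" "\<And>k. f k > 0"
  shows "s > 0"
  using assms suminf_pos[of f] by (simp add: sums_iff)

text \<open>
  The sign pattern \<open>alternates\<close> cancels the factor \<open>(-1)^k\<close> in the residues, so that all coefficients of the
  partial fraction expansion become positive.
\<close>

locale cos_interlaced = cos_dominated +
  assumes real_on_reals: "\<And>r. H (of_real r) \<in> \<real>"
    and alternates: "\<And>k. (-1) ^ k * Re (H (of_real ((cos_node k)\<^sup>2))) > 0"
    and positive: "\<And>r. r \<le> 0 \<Longrightarrow> Re (H (of_real r)) > 0"
begin

lemma of_real_Re_H: "H (of_real r) = of_real (Re (H (of_real r)))"
  using real_on_reals[of r] by (simp add: complex_eq_iff complex_is_Real_iff)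

definition node_weight :: "nat \<Rightarrow> real" where
  "node_weight k = 2 * ((-1) ^ k * Re (H (of_real ((cos_node k)\<^sup>2)))) / cos_node k"

lemma node_weight_pos: "node_weight k > 0"
  using alternates[of k] cos_node_pos[of k] by (simp add: node_weight_def)

lemma node_coeff_eq_weight: "node_coeff k = of_real (node_weight k)"
  unfolding node_coeff_def node_weight_def
  using of_real_Re_H[of "(cos_node k)\<^sup>2"] by simp

text \<open>
  The cosine is even, so \<open>cos (csqrt w)\<close> does not depend on the branch of the square root.
\<close>

definition quot :: "complex \<Rightarrow> complex" where
  "quot w = H w / cos (csqrt w)"

lemma cos_csqrt_nonzero:
  assumes "\<And>k. w \<noteq> of_real ((cos_node k)\<^sup>2)"
  shows "cos (csqrt w) \<noteq> 0"
proof
  assume "cos (csqrt w) = 0"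
  then obtain k where "csqrt w = of_real (cos_node k) \<or> csqrt w = - of_real (cos_node k)"
    using cos_eq_0_iff_cos_node by blast
  then have "(csqrt w)\<^sup>2 = of_real ((cos_node k)\<^sup>2)"
    by (auto simp del: power2_csqrt)
  then show False using assms[of k] by simp
qed

lemma quot_expansion:
  assumes "\<And>k. w \<noteq> of_real ((cos_node k)\<^sup>2)"
  shows "(\<lambda>k. of_real (node_weight k) * w / (of_real ((cos_node k)\<^sup>2) - w)) sums (quot w - H 0)"
proof (cases "w = 0")
  case True
  then show ?thesis by (simp add: quot_def)
next
  case False
  from partial_fractions[of "csqrt w"] cos_csqrt_nonzero[OF assms] False
  have "(\<lambda>k. of_real (node_weight k) / (of_real ((cos_node k)\<^sup>2) - w)) sums ((quot w - H 0) / w)"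
    by (simp add: node_coeff_eq_weight quot_def)
  from sums_mult[OF this, of w] show ?thesis
    using False by (simp add: mult_ac)
qed

text \<open>
  Every term of this divided difference has the shape \<open>a / ((x - w\<^sub>1) * (x - w\<^sub>2))\<close> with \<open>a > 0\<close>. For
  \<open>w\<^sub>1\<close> and \<open>w\<^sub>2\<close> in the same gap between nodes both factors have the same sign, which is the
  monotonicity of the quotient.
\<close>

lemma quot_difference:
  assumes 1: "\<And>k. w1 \<noteq> of_real ((cos_node k)\<^sup>2)" and 2: "\<And>k. w2 \<noteq> of_real ((cos_node k)\<^sup>2)"
    and "w1 \<noteq> w2"
  shows "(\<lambda>k. of_real (node_weight k * (cos_node k)\<^sup>2) /
            ((of_real ((cos_node k)\<^sup>2) - w1) * (of_real ((cos_node k)\<^sup>2) - w2)))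
           sums ((quot w2 - quot w1) / (w2 - w1))"
proof -
  have eq: "(of_real (node_weight k) * w2 / (of_real ((cos_node k)\<^sup>2) - w2)
          - of_real (node_weight k) * w1 / (of_real ((cos_node k)\<^sup>2) - w1)) / (w2 - w1)
        = of_real (node_weight k * (cos_node k)\<^sup>2) /
            ((of_real ((cos_node k)\<^sup>2) - w1) * (of_real ((cos_node k)\<^sup>2) - w2))" for k
  proof -
    have "a * w2 / (x - w2) - a * w1 / (x - w1) = (w2 - w1) * (a * x / ((x - w1) * (x - w2)))"
      if "x \<noteq> w1" "x \<noteq> w2" for a x :: complex
      using that by (simp add: field_simps)
    from this[of "of_real ((cos_node k)\<^sup>2)" "of_real (node_weight k)"] show ?thesis
      using 1[of k] 2[of k] \<open>w1 \<noteq> w2\<close> by auto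
  qed
  have "(\<lambda>k. of_real (node_weight k) * w2 / (of_real ((cos_node k)\<^sup>2) - w2)
          - of_real (node_weight k) * w1 / (of_real ((cos_node k)\<^sup>2) - w1)) sums (quot w2 - quot w1)"
    using sums_diff[OF quot_expansion[OF 2] quot_expansion[OF 1]] by simp
  from sums_divide[OF this, of "w2 - w1"] show ?thesis unfolding eq .
qed

lemma H_node_nonzero: "H (of_real ((cos_node k)\<^sup>2)) \<noteq> 0"
  using alternates[of k] by auto

text \<open>
  The imaginary part of each term of the expansion is a positive multiple of \<open>Im w\<close>, because
  \<open>w / (x - w) = - 1 + x / (x - w)\<close>. At a nonreal zero these imaginary parts would have to sum to that of
  the real number \<open>- H 0\<close>.
\<close>

lemma zero_real:
  assumes "H w = 0"
  shows "Im w = 0"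
proof (rule ccontr)
  assume im: "Im w \<noteq> 0"
  then have nn: "w \<noteq> of_real ((cos_node k)\<^sup>2)" for k by auto
  let ?f = "\<lambda>k. node_weight k * (cos_node k)\<^sup>2 / (norm (of_real ((cos_node k)\<^sup>2) - w))\<^sup>2"
  have eq: "Im (of_real (node_weight k) * w / (of_real ((cos_node k)\<^sup>2) - w)) = Im w * ?f k" for k
  proof -
    have "of_real (node_weight k) * w / (of_real ((cos_node k)\<^sup>2) - w)
       = of_real (node_weight k) * w * cnj (of_real ((cos_node k)\<^sup>2) - w)
          / of_real ((norm (of_real ((cos_node k)\<^sup>2) - w))\<^sup>2)"
      by (subst complex_div_cnj) simp
    then show ?thesis by (simp add: algebra_simps)
  qed
  have "(\<lambda>k. Im w * ?f k) sums Im (quot w - H 0)"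
    using sums_Im[OF quot_expansion[OF nn]] by (simp only: eq)
  then have "(\<lambda>k. Im w * ?f k) sums 0"
    using assms real_on_reals[of 0] by (simp add: quot_def complex_is_Real_iff)
  from sums_divide[OF this, of "Im w"] have "?f sums 0" using im by simp
  moreover have "?f k > 0" for k
    using node_weight_pos[of k] cos_node_pos[of k] nn[of k] by simp
  ultimately show False using sums_pos by fastforce
qed

text \<open>
  A zero is positive and not a node, so only the interval below the first node has to be excluded. There
  all terms of the expansion are positive, while at a zero they sum to \<open>- H 0 < 0\<close>.
\<close>

theorem zero_in_gap:
  assumes "H w = 0"
  obtains k r where "w = of_real r" "(cos_node k)\<^sup>2 < r" "r < (cos_node (Suc k))\<^sup>2"
proof -
  define r where "r = Re w"
  have w: "w = of_real r" using zero_real[OF assms] by (simp add: r_def complex_eq_iff)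
  have rpos: "r > 0" using positive[of r] assms w by force
  have ne: "r \<noteq> (cos_node k)\<^sup>2" for k using H_node_nonzero[of k] assms w by auto
  then have nn: "w \<noteq> of_real ((cos_node k)\<^sup>2)" for k unfolding w of_real_eq_iff .
  \<comment> \<open>The first node whose square exceeds \<open>r\<close> is the right end of the gap.\<close>
  have ex: "\<exists>n. r < (cos_node n)\<^sup>2"
  proof -
    obtain n :: nat where n: "r < real n" using reals_Archimedean2 by blast
    have "real n \<le> (real n + 1/2) * (real n + 1/2)" by (simp add: algebra_simps)
    also have "\<dots> \<le> (real n + 1/2) * (real n + 1/2) * pi\<^sup>2"
    proof -
      have "1 \<le> pi\<^sup>2" using pi_gt3 by (simp add: one_le_power)
      then show ?thesis using mult_left_mono[of 1 "pi\<^sup>2" "(real n + 1/2) * (real n + 1/2)"] by simp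
    qed
    also have "\<dots> = (cos_node n)\<^sup>2" by (simp add: cos_node_def power2_eq_square mult_ac)
    finally show ?thesis using n by (intro exI[of _ n]) linarith
  qed
  define n where "n = (LEAST n. r < (cos_node n)\<^sup>2)"
  have n: "r < (cos_node n)\<^sup>2" unfolding n_def by (rule LeastI_ex[OF ex])
  show thesis
  proof (cases n)
    case 0
    let ?f = "\<lambda>k. node_weight k * r / ((cos_node k)\<^sup>2 - r)"
    have "(\<lambda>k. complex_of_real (?f k)) sums (- H 0)"
      using quot_expansion[OF nn] assms by (simp add: quot_def w)
    from sums_Re[OF this] have "?f sums (- Re (H 0))" by simp
    moreover have "?f k > 0" for k
    proof -
      have "(cos_node 0)\<^sup>2 \<le> (cos_node k)\<^sup>2" by simp
      then have "r < (cos_node k)\<^sup>2" using n unfolding 0 by linarith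
      then show ?thesis using node_weight_pos[of k] rpos by simp
    qed
    ultimately have "- Re (H 0) > 0" by (rule sums_pos)
    then show ?thesis using positive[of 0] by simp
  next
    case (Suc k)
    then have "\<not> r < (cos_node k)\<^sup>2" using not_less_Least[of k "\<lambda>n. r < (cos_node n)\<^sup>2"] by (simp add: n_def)
    then have "(cos_node k)\<^sup>2 < r" using ne[of k] by simp
    with that w n Suc show ?thesis by blast
  qed
qed

lemma gap_denominator_pos:
  assumes "(cos_node k)\<^sup>2 < r" "r < (cos_node (Suc k))\<^sup>2" "(cos_node k)\<^sup>2 < s" "s < (cos_node (Suc k))\<^sup>2"
  shows "((cos_node j)\<^sup>2 - r) * ((cos_node j)\<^sup>2 - s) > 0"
proof (cases "j \<le> k")
  case True
  then have "(cos_node j)\<^sup>2 \<le> (cos_node k)\<^sup>2" by simp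
  then have "(cos_node j)\<^sup>2 < r" "(cos_node j)\<^sup>2 < s" using assms by linarith+
  then show ?thesis by (intro mult_neg_neg) auto
next
  case False
  then have "(cos_node (Suc k))\<^sup>2 \<le> (cos_node j)\<^sup>2" by simp
  then have "r < (cos_node j)\<^sup>2" "s < (cos_node j)\<^sup>2" using assms by linarith+
  then show ?thesis by (intro mult_pos_pos) auto
qed

lemma gap_ne_node:
  assumes "(cos_node k)\<^sup>2 < r" "r < (cos_node (Suc k))\<^sup>2"
  shows "complex_of_real r \<noteq> of_real ((cos_node j)\<^sup>2)"
  using gap_denominator_pos[OF assms assms, of j] unfolding of_real_eq_iff by auto

text \<open>
  Within a gap all terms of this sum are positive. Both the uniqueness of the zero of a gap and its
  simplicity rest on this.
\<close>

lemma quot_slope_sums: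
  assumes r: "(cos_node k)\<^sup>2 < r" "r < (cos_node (Suc k))\<^sup>2"
    and s: "(cos_node k)\<^sup>2 < s" "s < (cos_node (Suc k))\<^sup>2" and "r \<noteq> s" and "H (of_real r) = 0"
  shows "(\<lambda>j. node_weight j * (cos_node j)\<^sup>2 / (((cos_node j)\<^sup>2 - r) * ((cos_node j)\<^sup>2 - s)))
           sums Re (quot (of_real s) / of_real (s - r))"
proof -
  have "(\<lambda>j. complex_of_real (node_weight j * (cos_node j)\<^sup>2 / (((cos_node j)\<^sup>2 - r) * ((cos_node j)\<^sup>2 - s))))
           sums (quot (of_real s) / of_real (s - r))"
    using quot_difference[of "of_real r" "of_real s", OF gap_ne_node[OF r] gap_ne_node[OF s]] assms(5,6)
    by (simp add: quot_def)
  from sums_Re[OF this] show ?thesis by simp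
qed

theorem gap_zero_unique:
  assumes r: "(cos_node k)\<^sup>2 < r" "r < (cos_node (Suc k))\<^sup>2"
    and s: "(cos_node k)\<^sup>2 < s" "s < (cos_node (Suc k))\<^sup>2"
    and "H (of_real r) = 0" "H (of_real s) = 0"
  shows "r = s"
proof (rule ccontr)
  assume "r \<noteq> s"
  from quot_slope_sums[OF r s this assms(5)] assms(6)
  have "(\<lambda>j. node_weight j * (cos_node j)\<^sup>2 / (((cos_node j)\<^sup>2 - r) * ((cos_node j)\<^sup>2 - s))) sums 0"
    by (simp add: quot_def)
  moreover have "node_weight j * (cos_node j)\<^sup>2 / (((cos_node j)\<^sup>2 - r) * ((cos_node j)\<^sup>2 - s)) > 0" for j
    using node_weight_pos[of j] cos_node_pos[of j] gap_denominator_pos[OF r s, of j] by simp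
  ultimately show False using sums_pos by fastforce
qed

theorem gap_zero_exists:
  obtains r where "(cos_node k)\<^sup>2 < r" "r < (cos_node (Suc k))\<^sup>2" "H (of_real r) = 0"
proof -
  define h where "h r = (-1) ^ k * Re (H (of_real r))" for r
  have cont: "continuous_on A h" for A
    unfolding h_def
    by (intro continuous_intros continuous_on_compose2[OF holomorphic_on_imp_continuous_on[OF holo]]) auto
  have 1: "h ((cos_node k)\<^sup>2) > 0" using alternates[of k] by (simp add: h_def)
  have 2: "h ((cos_node (Suc k))\<^sup>2) < 0" using alternates[of "Suc k"] by (simp add: h_def)
  have le: "(cos_node k)\<^sup>2 \<le> (cos_node (Suc k))\<^sup>2" by simp
  obtain r where r: "(cos_node k)\<^sup>2 \<le> r" "r \<le> (cos_node (Suc k))\<^sup>2" "h r = 0"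
    using IVT2'[of h, OF less_imp_le[OF 2] less_imp_le[OF 1] le cont] by blast
  have "r \<noteq> (cos_node k)\<^sup>2" "r \<noteq> (cos_node (Suc k))\<^sup>2" using r 1 2 by auto
  moreover have "H (of_real r) = 0" using r(3) of_real_Re_H[of r] by (simp add: h_def)
  ultimately show thesis using that r by force
qed

text \<open>
  The secant slopes of the quotient at a zero \<open>r\<close> are sums of positive terms, hence at least the term of the
  node \<open>0\<close>, which stays away from zero as \<open>s\<close> tends to \<open>r\<close>. A double zero of \<open>H\<close> would make these slopes
  tend to zero.
\<close>

theorem zero_simple:
  assumes "H w = 0"
  shows "deriv H w \<noteq> 0"
proof
  assume d0: "deriv H w = 0"
  obtain k r where w: "w = of_real r" and r: "(cos_node k)\<^sup>2 < r" "r < (cos_node (Suc k))\<^sup>2"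
    using zero_in_gap[OF assms] .
  define g where "g j s = node_weight j * (cos_node j)\<^sup>2 / (((cos_node j)\<^sup>2 - r) * ((cos_node j)\<^sup>2 - s))" for j s
  have rpos: "r > 0" using r(1) zero_le_power2[of "cos_node k"] by linarith
  have "(H has_field_derivative 0) (at w)"
    using holomorphic_derivI[OF holo open_UNIV, of w] d0 by simp
  then have "((\<lambda>v. H v / (v - w)) \<longlongrightarrow> 0) (at w)"
    using assms by (simp add: has_field_derivative_iff)
  moreover have "filterlim complex_of_real (at w) (at_right r)"
    unfolding filterlim_at
    by (auto simp: w eventually_at_filter intro!: tendsto_intros)
  ultimately have lim1: "((\<lambda>s. H (of_real s) / (of_real s - w)) \<longlongrightarrow> 0) (at_right r)"
    by (rule filterlim_compose)
  have csqrt: "csqrt (of_real s) = complex_of_real (sqrt s)" if "s > 0" for s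
    using that by (intro of_real_sqrt[symmetric]) simp
  have "cos (complex_of_real (sqrt r)) \<noteq> 0"
    using cos_csqrt_nonzero[OF gap_ne_node[OF r]] unfolding csqrt[OF rpos] .
  then have "((\<lambda>s. H (of_real s) / (of_real s - w) / cos (of_real (sqrt s))) \<longlongrightarrow>
          0 / cos (complex_of_real (sqrt r))) (at_right r)"
    by (intro tendsto_intros lim1)
  then have limL: "((\<lambda>s. Re (H (of_real s) / (of_real s - w) / cos (of_real (sqrt s)))) \<longlongrightarrow> 0) (at_right r)"
    using tendsto_Re by fastforce
  have ne: "(cos_node 0)\<^sup>2 - r \<noteq> 0" using gap_denominator_pos[OF r r, of 0] by auto
  then have limR: "(g 0 \<longlongrightarrow> g 0 r) (at_right r)"
    unfolding g_def by (intro tendsto_intros) auto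
  have "eventually (\<lambda>s. r < s \<and> s < (cos_node (Suc k))\<^sup>2) (at_right r)"
    using eventually_at_right_real[OF r(2)] by (rule eventually_mono) auto
  then have "eventually (\<lambda>s. g 0 s \<le> Re (H (of_real s) / (of_real s - w) / cos (of_real (sqrt s)))) (at_right r)"
  proof eventually_elim
    case (elim s)
    then have s: "(cos_node k)\<^sup>2 < s" "s < (cos_node (Suc k))\<^sup>2" and "r \<noteq> s" using r by auto
    have "(\<lambda>j. g j s) sums Re (quot (of_real s) / of_real (s - r))"
      using quot_slope_sums[OF r s \<open>r \<noteq> s\<close>] assms w by (simp add: g_def)
    moreover have "g j s > 0" for j
      unfolding g_def
      using node_weight_pos[of j] cos_node_pos[of j] gap_denominator_pos[OF r s, of j] by simp
    ultimately have "g 0 s \<le> Re (quot (of_real s) / of_real (s - r))"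
      using sum_le_suminf[of "\<lambda>j. g j s" "{0}"] by (simp add: sums_iff less_imp_le)
    also have "quot (of_real s) / of_real (s - r) = H (of_real s) / (of_real s - w) / cos (of_real (sqrt s))"
    proof -
      have "s > 0" using rpos elim by linarith
      then show ?thesis unfolding quot_def csqrt[OF \<open>s > 0\<close>] by (simp add: w)
    qed
    finally show ?case .
  qed
  from tendsto_le[OF _ limL limR this] have "g 0 r \<le> 0" by simp
  moreover have "g 0 r > 0"
    unfolding g_def using node_weight_pos[of 0] cos_node_pos[of 0] gap_denominator_pos[OF r r, of 0] by simp
  ultimately show False by simp
qed

end

section \<open>Beta integrals\<close>

lemma nn_integral_Beta:
  fixes p q :: real
  assumes "p > 0" "q > 0"
  shows "(\<integral>\<^sup>+t. ennreal (indicator {0<..<1} t * (t powr (p - 1) * (1 - t) powr (q - 1))) \<partial>lborel)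
           = ennreal (Beta p q)"
proof -
  have eq: "indicator {0..1} t * (t powr (p - 1) * (1 - t) powr (q - 1))
      = indicator {0<..<1} t * (t powr (p - 1) * (1 - t) powr (q - 1))" for t :: real
    by (auto simp: indicator_def)
  show ?thesis
    using nn_integral_has_integral_lebesgue[OF _ has_integral_Beta_real[OF assms]] by (simp add: eq)
qed

lemma nn_integral_Beta_scaled:
  fixes p q w :: real
  assumes "p > 0" "q > 0" "w > 0"
  shows "(\<integral>\<^sup>+s. ennreal (indicator {0<..<w} s * (s powr (p - 1) * (w - s) powr (q - 1))) \<partial>lborel)
           = ennreal (w powr (p + q - 1) * Beta p q)"
proof -
  have eq: "ennreal (indicator {0<..<w} (0 + w * t) * ((0 + w * t) powr (p - 1) * (w - (0 + w * t)) powr (q - 1)))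
      = ennreal (w powr (p + q - 2)) *
          ennreal (indicator {0<..<1} t * (t powr (p - 1) * (1 - t) powr (q - 1)))" for t
  proof (cases "t \<in> {0<..<1}")
    case True
    have "(w * t) powr (p - 1) = w powr (p - 1) * t powr (p - 1)"
      using True assms by (simp add: powr_mult)
    moreover have "(w - w * t) powr (q - 1) = w powr (q - 1) * (1 - t) powr (q - 1)"
      using True assms powr_mult[of w "1 - t" "q - 1"] by (simp add: algebra_simps)
    moreover have "w powr (p - 1) * w powr (q - 1) = w powr (p + q - 2)"
      by (simp flip: powr_add)
    ultimately show ?thesis using True assms
      by (simp add: ennreal_mult'[symmetric] mult_less_cancel_left1 mult_ac)
  next
    case False
    then show ?thesis using assms by (auto simp: indicator_def zero_less_mult_iff)
  qed
  let ?f = "\<lambda>s. ennreal (indicator {0<..<w} s * (s powr (p - 1) * (w - s) powr (q - 1)))"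
  have "(\<integral>\<^sup>+s. ?f s \<partial>lborel) = ennreal \<bar>w\<bar> * (\<integral>\<^sup>+t. ?f (0 + w * t) \<partial>lborel)"
    using assms by (intro nn_integral_real_affine) auto
  also have "(\<integral>\<^sup>+t. ?f (0 + w * t) \<partial>lborel) = ennreal (w powr (p + q - 2)) * ennreal (Beta p q)"
    unfolding eq using assms by (subst nn_integral_cmult) (simp_all add: nn_integral_Beta)
  also have "ennreal \<bar>w\<bar> * (ennreal (w powr (p + q - 2)) * ennreal (Beta p q))
      = ennreal (w * w powr (p + q - 2) * Beta p q)"
    using assms by (simp add: ennreal_mult' mult.assoc)
  also have "w * w powr (p + q - 2) = w powr (p + q - 1)"
    using assms powr_add[of w 1 "p + q - 2"] by simp
  finally show ?thesis .
qed

lemma Beta_add_nat: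
  fixes p q :: real
  assumes "p > 0" "q > 0"
  shows "Beta (p + real n) q = Beta p q * pochhammer p n / pochhammer (p + q) n"
proof -
  have "p \<notin> \<int>\<^sub>\<le>\<^sub>0" "p + q \<notin> \<int>\<^sub>\<le>\<^sub>0" using assms by (auto elim!: nonpos_Ints_cases)
  moreover have "Gamma p > 0" "Gamma (p + q) > 0" "Gamma (p + q + n) > 0"
    using assms by (auto intro!: Gamma_real_pos)
  ultimately show ?thesis
    by (simp add: Beta_def pochhammer_Gamma add_ac field_simps)
qed

lemma Beta_real_pos: "Beta p q > 0" if "p > 0" "q > 0" for p q :: real
  using that by (auto simp: Beta_def intro!: divide_pos_pos mult_pos_pos Gamma_real_pos)

section \<open>An increasing weight with the moments of a product of Beta variables\<close>

locale cosine_params =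
  fixes b c :: real
  assumes b: "1/2 < b" "b < 1" and c: "1 < c" "c < 2" and bc: "b + c < 5/2"
begin

text \<open>
  Let \<open>V\<close> and \<open>W\<close> be independent with \<open>V\<close> distributed as Beta with parameters \<open>1/2, b - 1/2\<close> and \<open>W\<close> as
  Beta with parameters \<open>1, c - 1\<close>. Up to a constant, the product \<open>V * W\<close> has the density
  \<open>s powr (-1/2) * phi s\<close>, where \<open>phi s\<close> is the integral over \<open>s < w < 1\<close> of
  \<open>w powr (1 - b) * (w - s) powr (b - 3/2) * (1 - w) powr (c - 2)\<close>. The definitions below are the result
  of the substitution \<open>w = s + (1 - s) * u\<close>. In that form \<open>s\<close> occurs only in two factors that
  are increasing in it: \<open>(1 - s) powr (b + c - 5/2)\<close>, as \<open>b + c < 5/2\<close>, and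
  \<open>(u + (1 - u) * s) powr (1 - b)\<close>, as \<open>b < 1\<close>.
\<close>

definition beta_kernel :: "real \<Rightarrow> real" where
  "beta_kernel u = indicator {0<..<1} u * (u powr (b - 3/2) * (1 - u) powr (c - 2))"

definition psi :: "real \<Rightarrow> real" where
  "psi s = (LINT u|lborel. beta_kernel u * (u + (1 - u) * s) powr (1 - b))"

definition phi :: "real \<Rightarrow> real" where
  "phi s = (1 - s) powr (b + c - 5/2) * psi s"

lemma beta_kernel_nonneg: "beta_kernel u \<ge> 0"
  by (simp add: beta_kernel_def)

lemma beta_kernel_measurable [measurable]: "beta_kernel \<in> borel_measurable borel"
  unfolding beta_kernel_def by measurable

lemma beta_kernel_integrable: "integrable lborel beta_kernel"
proof (rule integrableI_nonneg)
  have "(\<integral>\<^sup>+u. ennreal (beta_kernel u) \<partial>lborel) = ennreal (Beta (b - 1/2) (c - 1))"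
    using nn_integral_Beta[of "b - 1/2" "c - 1"] b c by (simp add: beta_kernel_def algebra_simps)
  then show "(\<integral>\<^sup>+u. ennreal (beta_kernel u) \<partial>lborel) < \<infinity>" by simp
qed (use beta_kernel_nonneg in auto)

lemma psi_integrable:
  assumes "0 \<le> s" "s \<le> 1"
  shows "integrable lborel (\<lambda>u. beta_kernel u * (u + (1 - u) * s) powr (1 - b))"
proof (rule Bochner_Integration.integrable_bound[OF beta_kernel_integrable])
  have "beta_kernel u * (u + (1 - u) * s) powr (1 - b) \<le> beta_kernel u" for u
  proof (cases "u \<in> {0<..<1}")
    case True
    then have "(1 - u) * s \<le> (1 - u) * 1" using assms by (intro mult_left_mono) auto
    then have "u + (1 - u) * s \<le> 1" by (simp add: algebra_simps)
    then have "(u + (1 - u) * s) powr (1 - b) \<le> 1"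
      using True assms b by (intro powr_le1) auto
    then show ?thesis using beta_kernel_nonneg[of u] by (simp add: mult_left_le)
  qed (simp add: beta_kernel_def)
  then show "AE u in lborel. norm (beta_kernel u * (u + (1 - u) * s) powr (1 - b)) \<le> norm (beta_kernel u)"
    using beta_kernel_nonneg by (simp add: abs_mult)
qed simp

lemma psi_nonneg: "psi s \<ge> 0"
  unfolding psi_def using beta_kernel_nonneg by (intro integral_nonneg_AE) auto

lemma psi_mono:
  assumes "0 \<le> s" "s \<le> t" "t \<le> 1"
  shows "psi s \<le> psi t"
  unfolding psi_def
proof (rule integral_mono)
  fix u
  show "beta_kernel u * (u + (1 - u) * s) powr (1 - b) \<le> beta_kernel u * (u + (1 - u) * t) powr (1 - b)"
  proof (cases "u \<in> {0<..<1}")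
    case True
    then have "(u + (1 - u) * s) powr (1 - b) \<le> (u + (1 - u) * t) powr (1 - b)"
      using assms b by (intro powr_mono2 add_left_mono mult_left_mono) auto
    then show ?thesis using beta_kernel_nonneg by (rule mult_left_mono)
  qed (simp add: beta_kernel_def)
qed (use psi_integrable assms in auto)

lemma nn_integral_psi:
  assumes "0 \<le> s" "s \<le> 1"
  shows "(\<integral>\<^sup>+u. ennreal (beta_kernel u * (u + (1 - u) * s) powr (1 - b)) \<partial>lborel) = ennreal (psi s)"
  unfolding psi_def
  by (intro nn_integral_eq_integral psi_integrable assms) (auto simp: beta_kernel_nonneg)

lemma psi_0_pos: "psi 0 > 0"
proof -
  have eq: "beta_kernel u * (u + (1 - u) * 0) powr (1 - b)
     = indicator {0<..<1} u * (u powr (1/2 - 1) * (1 - u) powr (c - 1 - 1))" for u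
  proof -
    have "u powr (b - 3/2) * u powr (1 - b) = u powr (1/2 - 1)" by (simp flip: powr_add)
    then show ?thesis by (simp add: beta_kernel_def mult_ac)
  qed
  have "ennreal (psi 0) = ennreal (Beta (1/2) (c - 1))"
    using nn_integral_psi[of 0] nn_integral_Beta[of "1/2" "c - 1"] c unfolding eq by simp
  then have "psi 0 = Beta (1/2) (c - 1)"
    using psi_nonneg Beta_real_pos[of "1/2" "c - 1"] c by (simp add: ennreal_inj less_imp_le)
  then show ?thesis using Beta_real_pos[of "1/2" "c - 1"] c by simp
qed

lemma phi_nonneg: "phi s \<ge> 0"
  by (simp add: phi_def psi_nonneg)

lemma phi_0_pos: "phi 0 > 0"
  using psi_0_pos by (simp add: phi_def)

lemma phi_mono:
  assumes "0 \<le> s" "s \<le> t" "t < 1"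
  shows "phi s \<le> phi t"
  unfolding phi_def
  using assms bc by (intro mult_mono powr_mono2' psi_mono) (auto simp: psi_nonneg)

lemma psi_measurable [measurable]: "psi \<in> borel_measurable borel"
  unfolding psi_def by measurable

lemma phi_measurable [measurable]: "phi \<in> borel_measurable borel"
  unfolding phi_def by measurable

text \<open>
  The substitution \<open>w = s + (1 - s) * u\<close>, under which \<open>w - s = (1 - s) * u\<close> and
  \<open>1 - w = (1 - s) * (1 - u)\<close>.
\<close>

lemma nn_integral_phi:
  assumes s: "0 < s" "s < 1"
  shows "(\<integral>\<^sup>+w. ennreal (indicator {s<..<1} w *
            (w powr (1 - b) * (w - s) powr (b - 3/2) * (1 - w) powr (c - 2))) \<partial>lborel) = ennreal (phi s)"
proof -
  have eq: "ennreal (indicator {s<..<1} (s + (1 - s) * u) * ((s + (1 - s) * u) powr (1 - b) *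
             (s + (1 - s) * u - s) powr (b - 3/2) * (1 - (s + (1 - s) * u)) powr (c - 2)))
      = ennreal ((1 - s) powr (b + c - 7/2)) * ennreal (beta_kernel u * (u + (1 - u) * s) powr (1 - b))" for u
  proof (cases "u \<in> {0<..<1}")
    case True
    have ind: "s + (1 - s) * u \<in> {s<..<1}"
    proof -
      have "(1 - s) * u < (1 - s) * 1" using True s by (intro mult_strict_left_mono) auto
      then have "s + (1 - s) * u < 1" by (simp add: algebra_simps)
      then show ?thesis using True s by simp
    qed
    have 1: "(s + (1 - s) * u - s) powr (b - 3/2) = (1 - s) powr (b - 3/2) * u powr (b - 3/2)"
      using True s by (simp add: powr_mult)
    have "1 - (s + (1 - s) * u) = (1 - s) * (1 - u)" by (simp add: algebra_simps)
    then have 2: "(1 - (s + (1 - s) * u)) powr (c - 2) = (1 - s) powr (c - 2) * (1 - u) powr (c - 2)"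
      using True s by (simp add: powr_mult)
    have 3: "(1 - s) powr (b - 3/2) * (1 - s) powr (c - 2) = (1 - s) powr (b + c - 7/2)"
      by (simp flip: powr_add)
    have 4: "s + u * (1 - s) = u + s * (1 - u)" by (simp add: algebra_simps)
    show ?thesis using True ind
      unfolding 1 2 3[symmetric] by (simp add: beta_kernel_def ennreal_mult'[symmetric] mult_ac 4)
  next
    case False
    then have "s + (1 - s) * u \<notin> {s<..<1}"
    proof -
      have "s + (1 - s) * u \<ge> 1" if "u \<ge> 1"
        using s mult_left_mono[of 1 u "1 - s"] that by (simp add: algebra_simps)
      moreover have "s + (1 - s) * u \<le> s" if "u \<le> 0"
        using s that by (simp add: mult_nonneg_nonpos)
      ultimately show ?thesis using False by force
    qed
    then show ?thesis using False by (simp add: beta_kernel_def)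
  qed
  let ?f = "\<lambda>w. ennreal (indicator {s<..<1} w *
            (w powr (1 - b) * (w - s) powr (b - 3/2) * (1 - w) powr (c - 2)))"
  have "(\<integral>\<^sup>+w. ?f w \<partial>lborel) = ennreal \<bar>1 - s\<bar> * (\<integral>\<^sup>+u. ?f (s + (1 - s) * u) \<partial>lborel)"
    using s by (intro nn_integral_real_affine) auto
  also have "(\<integral>\<^sup>+u. ?f (s + (1 - s) * u) \<partial>lborel) = ennreal ((1 - s) powr (b + c - 7/2)) * ennreal (psi s)"
    unfolding eq using s by (subst nn_integral_cmult) (simp_all add: nn_integral_psi)
  also have "ennreal \<bar>1 - s\<bar> * (ennreal ((1 - s) powr (b + c - 7/2)) * ennreal (psi s))
      = ennreal ((1 - s) * (1 - s) powr (b + c - 7/2) * psi s)"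
    using s by (simp add: ennreal_mult' mult.assoc)
  also have "(1 - s) * (1 - s) powr (b + c - 7/2) = (1 - s) powr (b + c - 5/2)"
    using s powr_add[of "1 - s" 1 "b + c - 7/2"] by simp
  finally show ?thesis by (simp add: phi_def)
qed

definition cosine_density :: "real \<Rightarrow> real" where
  "cosine_density s = indicator {0<..<1} s * (s powr (-1/2) * phi s)"

lemma density_nonneg: "cosine_density s \<ge> 0"
  by (simp add: cosine_density_def phi_nonneg)

lemma density_measurable [measurable]: "cosine_density \<in> borel_measurable borel"
  unfolding cosine_density_def by measurable

text \<open>
  After exchanging the order of integration, the inner integral over \<open>0 < s < w\<close> is a Beta integral scaled
  by \<open>w\<close>. The power of \<open>w\<close> that it leaves combines with \<open>w powr (1 - b)\<close> to \<open>w ^ n\<close>, and the outer integral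
  is a Beta integral again.
\<close>

lemma nn_integral_moment:
  "(\<integral>\<^sup>+s. ennreal (cosine_density s * s ^ n) \<partial>lborel)
     = ennreal (Beta (1/2 + real n) (b - 1/2) * Beta (1 + real n) (c - 1))"
proof -
  let ?K = "\<lambda>s w. ennreal (indicator {0<..<w} s * (s powr (1/2 + real n - 1) * (w - s) powr (b - 1/2 - 1))) *
                 ennreal (indicator {0<..<1} w * (w powr (1 - b) * (1 - w) powr (c - 2)))"
  have K1: "ennreal (cosine_density s * s ^ n) = (\<integral>\<^sup>+w. ?K s w \<partial>lborel)" for s
  proof (cases "s \<in> {0<..<1}")
    case True
    have *: "s powr (1/2 + real n - 1) = s powr (-1/2) * s ^ n"
      using True powr_add[of s "-1/2" "real n"] by (simp add: powr_realpow)
    have "?K s w = ennreal (s powr (1/2 + real n - 1)) * ennreal (indicator {s<..<1} w *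
            (w powr (1 - b) * (w - s) powr (b - 3/2) * (1 - w) powr (c - 2)))" for w
      using True by (auto simp: indicator_def ennreal_mult'[symmetric] mult_ac)
    then have "(\<integral>\<^sup>+w. ?K s w \<partial>lborel) = ennreal (s powr (1/2 + real n - 1)) * ennreal (phi s)"
      using True by (simp add: nn_integral_cmult nn_integral_phi)
    moreover have "cosine_density s * s ^ n = s powr (1/2 + real n - 1) * phi s"
      unfolding * using True by (simp add: cosine_density_def)
    ultimately show ?thesis by (simp only: ennreal_mult' powr_ge_zero)
  next
    case False
    then have K0: "?K s w = 0" for w by (auto simp: indicator_def)
    show ?thesis unfolding K0 using False by (simp add: cosine_density_def)
  qed
  have K2: "(\<integral>\<^sup>+s. ?K s w \<partial>lborel) = ennreal (Beta (1/2 + real n) (b - 1/2)) *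
     ennreal (indicator {0<..<1} w * (w powr (1 + real n - 1) * (1 - w) powr (c - 1 - 1)))" for w
  proof (cases "w \<in> {0<..<1}")
    case True
    have "w powr (real n + b - 1) * w powr (1 - b) = w powr real n" by (simp flip: powr_add)
    moreover have "(\<integral>\<^sup>+s. ?K s w \<partial>lborel) = ennreal (w powr (1/2 + real n + (b - 1/2) - 1) * Beta (1/2 + real n) (b - 1/2))
         * ennreal (indicator {0<..<1} w * (w powr (1 - b) * (1 - w) powr (c - 2)))"
      using True b nn_integral_Beta_scaled[of "1/2 + real n" "b - 1/2" w] by (simp add: nn_integral_multc)
    ultimately show ?thesis using True Beta_real_pos[of "1/2 + real n" "b - 1/2"] b
      by (simp add: ennreal_mult'[symmetric] mult_ac add_ac)
  qed simp
  have "(\<integral>\<^sup>+s. ennreal (cosine_density s * s ^ n) \<partial>lborel) = (\<integral>\<^sup>+w. (\<integral>\<^sup>+s. ?K s w \<partial>lborel) \<partial>lborel)"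
    unfolding K1
  proof (rule lborel_pair.Fubini')
    show "(\<lambda>(w, s). ?K s w) \<in> borel_measurable (lborel \<Otimes>\<^sub>M lborel)"
      unfolding indicator_def greaterThanLessThan_iff by measurable
  qed
  also have "\<dots> = ennreal (Beta (1/2 + real n) (b - 1/2)) * ennreal (Beta (1 + real n) (c - 1))"
    unfolding K2 using c by (subst nn_integral_cmult) (simp_all add: nn_integral_Beta[of "1 + real n" "c - 1", simplified])
  finally show ?thesis using Beta_real_pos[of "1/2 + real n" "b - 1/2"] b by (simp add: ennreal_mult')
qed

end

section \<open>The hypergeometric function as a cosine transform\<close>

lemma cos_even_series:
  fixes z :: complex
  shows "(\<lambda>n. (-1) ^ n * z ^ (2 * n) / fact (2 * n)) sums cos z"
proof -
  have "(\<lambda>n. cos_coeff (2 * n) *\<^sub>R z ^ (2 * n)) sums cos z"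
    using cos_converges[of z]
    by (subst sums_mono_reindex[where f = "\<lambda>n. cos_coeff n *\<^sub>R z ^ n"])
       (auto simp: strict_mono_def cos_coeff_def elim!: evenE)
  moreover have "cos_coeff (2 * n) *\<^sub>R z ^ (2 * n) = (-1) ^ n * z ^ (2 * n) / fact (2 * n)" for n
    by (simp add: cos_coeff_def scaleR_conv_of_real)
  ultimately show ?thesis by simp
qed

context cosine_params
begin

definition mass :: real where
  "mass = Beta (1/2) (b - 1/2) * Beta 1 (c - 1)"

lemma mass_pos: "mass > 0"
  using b c by (simp add: mass_def Beta_real_pos)

lemma moment_nonneg: "cosine_density s * s ^ n \<ge> 0"
  by (cases "s \<in> {0<..<1}") (simp_all add: cosine_density_def phi_nonneg)

text \<open>
  Division by \<open>fact (2 * n) = 4 ^ n * pochhammer (1/2) n * fact n\<close> cancels the numerators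
  \<open>pochhammer (1/2) n\<close> and \<open>pochhammer 1 n\<close> of the two Beta values, so that only the coefficients of the
  hypergeometric series remain.
\<close>

lemma
  shows density_power_integrable: "integrable lborel (\<lambda>s. cosine_density s * s ^ n)"
    and moment: "(LINT s|lborel. cosine_density s * s ^ n) / fact (2 * n)
          = mass / (4 ^ n * (pochhammer b n * pochhammer c n))"
proof -
  let ?B = "Beta (1/2 + real n) (b - 1/2) * Beta (1 + real n) (c - 1)"
  have B: "?B \<ge> 0" using b c Beta_real_pos[of "1/2 + real n" "b - 1/2"] Beta_real_pos[of "1 + real n" "c - 1"] by simp
  have "has_bochner_integral lborel (\<lambda>s. cosine_density s * s ^ n) ?B"
    using nn_integral_moment[of n] B moment_nonneg by (intro has_bochner_integral_nn_integral) auto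
  then have J: "(LINT s|lborel. cosine_density s * s ^ n) = ?B" and int: "integrable lborel (\<lambda>s. cosine_density s * s ^ n)"
    by (simp_all add: has_bochner_integral_iff)
  show "integrable lborel (\<lambda>s. cosine_density s * s ^ n)" by (fact int)
  have "Beta (1/2 + real n) (b - 1/2) = Beta (1/2) (b - 1/2) * pochhammer (1/2) n / pochhammer b n"
    using Beta_add_nat[of "1/2" "b - 1/2" n] b by simp
  moreover have "Beta (1 + real n) (c - 1) = Beta 1 (c - 1) * fact n / pochhammer c n"
    using Beta_add_nat[of 1 "c - 1" n] c by (simp add: pochhammer_fact[symmetric])
  moreover have "pochhammer (1/2 :: real) n \<noteq> 0" using pochhammer_pos[of "1/2::real" n] by simp
  ultimately show "(LINT s|lborel. cosine_density s * s ^ n) / fact (2 * n)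
          = mass / (4 ^ n * (pochhammer b n * pochhammer c n))"
    unfolding J fact_double mass_def by (simp add: power_mult)
qed

lemma moment_le: "(LINT s|lborel. cosine_density s * s ^ n) \<le> mass"
proof -
  have "(LINT s|lborel. cosine_density s * s ^ n) \<le> (LINT s|lborel. cosine_density s * s ^ 0)"
  proof (rule integral_mono)
    fix s
    show "cosine_density s * s ^ n \<le> cosine_density s * s ^ 0"
      by (cases "s \<in> {0<..<1}") (auto simp: cosine_density_def phi_nonneg power_le_one mult_left_le)
  qed (rule density_power_integrable)+
  also have "\<dots> = mass" using moment[of 0] by simp
  finally show ?thesis .
qed

lemma density_integrable: "integrable lborel cosine_density"
  using density_power_integrable[of 0] by simp

lemma density_bounded_integrable:
  fixes f :: "real \<Rightarrow> 'b :: {banach, second_countable_topology}"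
  assumes [measurable]: "f \<in> borel_measurable borel" and "\<And>s. 0 < s \<Longrightarrow> s < 1 \<Longrightarrow> norm (f s) \<le> C"
  shows "integrable lborel (\<lambda>s. cosine_density s *\<^sub>R f s)"
proof (rule Bochner_Integration.integrable_bound)
  show "integrable lborel (\<lambda>s. C * cosine_density s)" using density_integrable by simp
  have "norm (cosine_density s *\<^sub>R f s) \<le> norm (C * cosine_density s)" for s
  proof (cases "s \<in> {0<..<1}")
    case True
    have "C \<ge> 0" using assms(2)[of "1/2"] norm_ge_zero[of "f (1/2)"] by linarith
    with True assms(2)[of s] show ?thesis
      by (simp add: abs_mult density_nonneg mult.commute mult_right_mono)
  qed (simp add: cosine_density_def)
  then show "AE s in lborel. norm (cosine_density s *\<^sub>R f s) \<le> norm (C * cosine_density s)" by simp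
qed simp

lemma norm_cos_sqrt_le:
  assumes "0 < s" "s < 1"
  shows "norm (cos (z * of_real (sqrt s))) \<le> exp \<bar>Im z\<bar>"
  using cmod_cos_le_exp[of "sqrt s" z] assms by (simp add: scaleR_conv_of_real mult.commute)

lemma density_cos_integrable: "integrable lborel (\<lambda>s. cosine_density s *\<^sub>R cos (z * complex_of_real (sqrt s)))"
proof (rule density_bounded_integrable)
  show "norm (cos (z * complex_of_real (sqrt s))) \<le> exp \<bar>Im z\<bar>" if "0 < s" "s < 1" for s
    using that by (rule norm_cos_sqrt_le)
  have "continuous_on UNIV (\<lambda>s. cos (z * complex_of_real (sqrt s)))" by (intro continuous_intros)
  then show "(\<lambda>s. cos (z * complex_of_real (sqrt s))) \<in> borel_measurable borel"
    by (rule borel_measurable_continuous_onI)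
qed

text \<open>
  Expand the cosine and integrate term by term. The moments are bounded by \<open>mass\<close>, so the series
  of the integrated norms is dominated by \<open>mass\<close> times the series of \<open>cosh (norm z)\<close>.
\<close>

theorem cosine_transform_sums:
  fixes z :: complex
  shows "(\<lambda>n. of_real mass * ((- (z\<^sup>2) / 4) ^ n / (pochhammer (of_real b) n * pochhammer (of_real c) n)))
           sums (LINT s|lborel. cosine_density s *\<^sub>R cos (z * of_real (sqrt s)))"
proof -
  let ?t = "\<lambda>n s. complex_of_real (cosine_density s * s ^ n) * ((- (z\<^sup>2)) ^ n / fact (2 * n))"
  have ser: "(\<lambda>n. ?t n s) sums (cosine_density s *\<^sub>R cos (z * of_real (sqrt s)))" for s
  proof (cases "s \<in> {0<..<1}")
    case True
    have "(-1) ^ n * (z * of_real (sqrt s)) ^ (2 * n) / fact (2 * n)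
        = of_real (s ^ n) * ((- (z\<^sup>2)) ^ n / fact (2 * n))" for n
    proof -
      have "(z * of_real (sqrt s)) ^ (2 * n) = (z\<^sup>2) ^ n * (complex_of_real ((sqrt s)\<^sup>2)) ^ n"
        by (simp add: power_mult_distrib power_mult)
      also have "(sqrt s)\<^sup>2 = s" using True by simp
      finally show ?thesis by (simp add: power_minus[of "z\<^sup>2"])
    qed
    then have "(\<lambda>n. of_real (s ^ n) * ((- (z\<^sup>2)) ^ n / fact (2 * n))) sums cos (z * of_real (sqrt s))"
      using cos_even_series[of "z * of_real (sqrt s)"] by simp
    from sums_mult[OF this, of "of_real (cosine_density s)"] show ?thesis
      by (simp add: scaleR_conv_of_real mult_ac)
  qed (simp add: cosine_density_def)
  have int: "integrable lborel (?t n)" for n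
    using density_power_integrable[of n] by (intro integrable_mult_left integrable_of_real)
  have norm_t: "norm (?t n s) = cosine_density s * s ^ n * (norm z ^ (2 * n) / fact (2 * n))" for n s
    using moment_nonneg[of s n]
    by (simp add: norm_mult norm_divide norm_power power_mult del: of_real_mult of_real_power)
  have summ: "summable (\<lambda>n. norm z ^ (2 * n) / fact (2 * n))"
  proof -
    have "summable (\<lambda>n. norm (cos_coeff (2 * n) *\<^sub>R norm z ^ (2 * n)))"
      using summable_norm_cos[of "norm z"]
      by (subst summable_mono_reindex[where f = "\<lambda>n. norm (cos_coeff n *\<^sub>R norm z ^ n)"])
         (auto simp: strict_mono_def cos_coeff_def elim!: evenE)
    then show ?thesis by (simp add: cos_coeff_def abs_mult)
  qed
  have "(\<lambda>n. integral\<^sup>L lborel (?t n)) sums (LINT s|lborel. (\<Sum>n. ?t n s))"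
  proof (rule sums_integral[OF int])
    have "summable (\<lambda>n. norm (?t n s))" for s
    proof (rule summable_comparison_test'[OF summable_mult[OF summ, of "cosine_density s"]])
      fix n :: nat
      have "cosine_density s * s ^ n \<le> cosine_density s"
        by (cases "s \<in> {0<..<1}") (auto simp: cosine_density_def phi_nonneg power_le_one mult_left_le)
      then have "norm (?t n s) \<le> cosine_density s * (norm z ^ (2 * n) / fact (2 * n))"
        unfolding norm_t by (intro mult_right_mono) auto
      then show "norm (norm (?t n s)) \<le> cosine_density s * (norm z ^ (2 * n) / fact (2 * n))"
        by (subst real_norm_def, subst abs_norm_cancel)
    qed
    then show "AE s in lborel. summable (\<lambda>n. norm (?t n s))" by simp
    show "summable (\<lambda>n. LINT s|lborel. norm (?t n s))"
    proof (rule summable_comparison_test'[OF summable_mult[OF summ, of mass]])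
      fix n :: nat
      have "(LINT s|lborel. norm (?t n s)) = (LINT s|lborel. cosine_density s * s ^ n) * (norm z ^ (2 * n) / fact (2 * n))"
        unfolding norm_t by simp
      moreover have "0 \<le> (LINT s|lborel. cosine_density s * s ^ n)" using moment_nonneg by simp
      ultimately show "norm (LINT s|lborel. norm (?t n s)) \<le> mass * (norm z ^ (2 * n) / fact (2 * n))"
        using moment_le[of n] by (simp add: abs_mult mult_right_mono divide_right_mono)
    qed
  qed
  also have "(\<lambda>s. \<Sum>n. ?t n s) = (\<lambda>s. cosine_density s *\<^sub>R cos (z * of_real (sqrt s)))"
    using ser by (simp add: sums_iff)
  also have "(\<lambda>n. integral\<^sup>L lborel (?t n)) =
    (\<lambda>n. of_real mass * ((- (z\<^sup>2) / 4) ^ n / (pochhammer (of_real b) n * pochhammer (of_real c) n)))"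
  proof
    fix n
    have "integral\<^sup>L lborel (?t n) = of_real (LINT s|lborel. cosine_density s * s ^ n) * ((- (z\<^sup>2)) ^ n / fact (2 * n))"
      by (simp del: of_real_mult)
    also have "\<dots> = of_real ((LINT s|lborel. cosine_density s * s ^ n) / fact (2 * n)) * (- (z\<^sup>2)) ^ n" by simp
    also have "\<dots> = of_real mass * ((- (z\<^sup>2) / 4) ^ n / (pochhammer (of_real b) n * pochhammer (of_real c) n))"
      unfolding moment power_divide[of "- (z\<^sup>2)"] by (simp add: pochhammer_of_real mult_ac)
    finally show "integral\<^sup>L lborel (?t n) = \<dots>" .
  qed
  finally show ?thesis .
qed

abbreviation F :: "complex \<Rightarrow> complex" where
  "F \<equiv> hypergeometric_1F2 1 (of_real b) (of_real c)"

text \<open>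
  Convergence of the hypergeometric series everywhere is read off from that of the transform, every complex
  number being of the form \<open>- z\<^sup>2 / 4\<close>.
\<close>

lemma F_sums:
  "(\<lambda>n. z ^ n / (pochhammer (of_real b) n * pochhammer (of_real c) n)) sums F z"
proof -
  let ?c = "\<lambda>n. z ^ n / (pochhammer (complex_of_real b) n * pochhammer (of_real c) n)"
  have "summable (\<lambda>n. complex_of_real mass * ?c n)"
    using sums_summable[OF cosine_transform_sums[of "csqrt (- 4 * z)"]] by simp
  then have "summable ?c" using mass_pos by (simp only: summable_cmult_iff) simp
  moreover have "F z = suminf ?c"
    unfolding hypergeometric_1F2_series by (simp add: pochhammer_fact[symmetric])
  ultimately show ?thesis by (simp add: summable_sums)
qed

lemma F_holomorphic: "F holomorphic_on A"
proof -
  let ?f = "fps_hypergeo [1] [complex_of_real b, of_real c] 1"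
  have "fps_conv_radius ?f = \<infinity>"
    unfolding fps_conv_radius_def
  proof (rule conv_radius_inftyI'')
    fix z :: complex
    show "summable (\<lambda>n. fps_nth ?f n * z ^ n)"
      using sums_summable[OF F_sums[of z]] by (simp add: pochhammer_fact[symmetric])
  qed
  then show ?thesis unfolding hypergeometric_1F2_def by (intro holomorphic_on_eval_fps) auto
qed

theorem F_cosine_transform:
  "of_real mass * F (- (z\<^sup>2) / 4) = (LINT s|lborel. cosine_density s *\<^sub>R cos (z * of_real (sqrt s)))"
  using sums_mult[OF F_sums, of "of_real mass"] cosine_transform_sums sums_unique2 by blast

lemma F_dominated: "norm (F (- (z\<^sup>2) / 4)) \<le> exp \<bar>Im z\<bar>"
proof -
  have "norm (of_real mass * F (- (z\<^sup>2) / 4)) \<le> (LINT s|lborel. exp \<bar>Im z\<bar> * cosine_density s)"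
    unfolding F_cosine_transform
  proof (rule Bochner_Integration.integral_norm_bound_integral[OF density_cos_integrable])
    fix s
    show "norm (cosine_density s *\<^sub>R cos (z * complex_of_real (sqrt s))) \<le> exp \<bar>Im z\<bar> * cosine_density s"
      using norm_cos_sqrt_le[of s z] density_nonneg[of s]
      by (cases "s \<in> {0<..<1}") (auto simp: mult.commute mult_right_mono cosine_density_def)
  qed (use density_integrable in simp)
  also have "\<dots> = exp \<bar>Im z\<bar> * mass" using moment[of 0] by simp
  finally show ?thesis using mass_pos by (simp add: norm_mult)
qed

lemma F_real: "F (of_real r) \<in> \<real>"
proof -
  have "(\<lambda>n. of_real r ^ n / (pochhammer (of_real b) n * pochhammer (of_real c) n)) sums F (of_real r)"
    by (rule F_sums)
  then have "(\<lambda>n. complex_of_real (r ^ n / (pochhammer b n * pochhammer c n))) sums F (of_real r)"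
    by (simp add: pochhammer_of_real)
  from sums_Im[OF this] have "Im (F (of_real r)) = 0" using sums_unique2[OF _ sums_zero] by simp
  then show ?thesis by (simp add: complex_is_Real_iff)
qed

lemma F_pos:
  assumes "r \<ge> 0"
  shows "Re (F (of_real r)) > 0"
proof -
  have "(\<lambda>n. complex_of_real (r ^ n / (pochhammer b n * pochhammer c n))) sums F (of_real r)"
    using F_sums[of "of_real r"] by (simp add: pochhammer_of_real)
  from sums_Re[OF this] have S: "(\<lambda>n. r ^ n / (pochhammer b n * pochhammer c n)) sums Re (F (of_real r))"
    by simp
  have "r ^ n / (pochhammer b n * pochhammer c n) \<ge> 0" for n
    using assms b c pochhammer_pos[of b n] pochhammer_pos[of c n] by simp
  then have "(\<Sum>n\<in>{0}. r ^ n / (pochhammer b n * pochhammer c n)) \<le> Re (F (of_real r))"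
    using S sum_le_suminf[of "\<lambda>n. r ^ n / (pochhammer b n * pochhammer c n)" "{0}"] by (simp add: sums_iff)
  then show ?thesis by simp
qed

end

section \<open>Signs at the zeros of the cosine\<close>

lemma one_minus_half_square_le_cos: "1 - y\<^sup>2 / 2 \<le> cos y" for y :: real
proof -
  have "\<bar>sin (y / 2)\<bar> \<le> \<bar>y / 2\<bar>" by (rule abs_sin_x_le_abs_x)
  then have "(sin (y / 2))\<^sup>2 \<le> (y / 2)\<^sup>2" unfolding abs_le_square_iff .
  moreover have "cos y = 1 - 2 * (sin (y / 2))\<^sup>2" using cos_double_sin[of "y / 2"] by simp
  ultimately show ?thesis by (simp add: power_divide)
qed

lemma cos_sqrt_kernel_integral:
  fixes x d e :: real
  assumes "x > 0" "0 \<le> d" "d \<le> e"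
  shows "((\<lambda>s. s powr (-1/2) * cos (x * sqrt s)) has_integral
            2 / x * (sin (x * sqrt e) - sin (x * sqrt d))) {d..e}"
proof -
  have "((\<lambda>s. s powr (-1/2) * cos (x * sqrt s)) has_integral
            2 / x * sin (x * sqrt e) - 2 / x * sin (x * sqrt d)) {d..e}"
  proof (rule fundamental_theorem_of_calculus_interior[OF assms(3), where f = "\<lambda>s. 2 / x * sin (x * sqrt s)"])
    show "continuous_on {d..e} (\<lambda>s. 2 / x * sin (x * sqrt s))"
      by (intro continuous_intros)
    fix s assume "s \<in> {d<..<e}"
    then have s: "s > 0" using assms by auto
    have "((\<lambda>s. 2 / x * sin (x * sqrt s)) has_field_derivative
            2 / x * (cos (x * sqrt s) * (x * (inverse (sqrt s) / 2)))) (at s)"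
      by (intro DERIV_cmult DERIV_chain2[OF DERIV_sin] DERIV_real_sqrt s)
    also have "2 / x * (cos (x * sqrt s) * (x * (inverse (sqrt s) / 2))) = s powr (-1/2) * cos (x * sqrt s)"
      using s assms(1) powr_minus[of s "1/2"] powr_half_sqrt[of s] by simp
    finally have "((\<lambda>s. 2 / x * sin (x * sqrt s)) has_field_derivative s powr (-1/2) * cos (x * sqrt s)) (at s)" .
    then show "((\<lambda>s. 2 / x * sin (x * sqrt s)) has_vector_derivative s powr (-1/2) * cos (x * sqrt s)) (at s)"
      by (rule has_real_derivative_iff_has_vector_derivative[THEN iffD1])
  qed
  then show ?thesis by (simp add: right_diff_distrib)
qed

context cosine_params
begin

lemma density_cos_has_integral:
  "((\<lambda>s. phi s * (s powr (-1/2) * cos (x * sqrt s))) has_integral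
      mass * Re (F (of_real (- (x\<^sup>2) / 4)))) {0..1}"
proof -
  have int: "integrable lborel (\<lambda>s. cosine_density s *\<^sub>R cos (x * sqrt s))"
  proof (rule density_bounded_integrable)
    show "(\<lambda>s. cos (x * sqrt s)) \<in> borel_measurable borel" by measurable
    show "norm (cos (x * sqrt s)) \<le> 1" for s by simp
  qed
  have cx: "complex_of_real (cosine_density s *\<^sub>R cos (x * sqrt s))
      = cosine_density s *\<^sub>R cos (complex_of_real x * of_real (sqrt s))" for s
  proof -
    have "cos (complex_of_real x * of_real (sqrt s)) = of_real (cos (x * sqrt s))"
      using cos_of_real[of "x * sqrt s", where 'a = complex] unfolding of_real_mult .
    then show ?thesis unfolding scaleR_conv_of_real by simp
  qed
  have "complex_of_real (LINT s|lborel. cosine_density s *\<^sub>R cos (x * sqrt s))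
      = (LINT s|lborel. cosine_density s *\<^sub>R cos (complex_of_real x * of_real (sqrt s)))"
    by (simp only: cx[symmetric] integral_complex_of_real)
  also have "\<dots> = of_real mass * F (of_real (- (x\<^sup>2) / 4))"
    using F_cosine_transform[of "of_real x"] by simp
  finally have "Re (complex_of_real (LINT s|lborel. cosine_density s *\<^sub>R cos (x * sqrt s)))
      = Re (of_real mass * F (of_real (- (x\<^sup>2) / 4)))" by (rule arg_cong)
  then have "(LINT s|lborel. cosine_density s *\<^sub>R cos (x * sqrt s)) = mass * Re (F (of_real (- (x\<^sup>2) / 4)))"
    by simp
  then have "((\<lambda>s. cosine_density s *\<^sub>R cos (x * sqrt s)) has_integral mass * Re (F (of_real (- (x\<^sup>2) / 4)))) UNIV"
    using has_integral_integral_lborel[OF int] by simp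
  also have "(\<lambda>s. cosine_density s *\<^sub>R cos (x * sqrt s)) =
     (\<lambda>s. if s \<in> {0..1} then phi s * (s powr (-1/2) * cos (x * sqrt s)) else 0)"
    by (auto simp: cosine_density_def fun_eq_iff phi_def indicator_def)
  finally show ?thesis by (simp only: has_integral_restrict_UNIV)
qed

text \<open>
  The second mean value theorem for the increasing function \<open>phi\<close> leaves
  \<open>phi 0 * S a + phi t * (S t - S a)\<close>, where \<open>S\<close> is the antiderivative of the kernel normalised to \<open>\<bar>S\<bar> \<le> 1\<close>
  and \<open>S 1 = 1\<close>. Since \<open>phi t \<ge> phi 0\<close>, the worst case is \<open>S a = 1\<close>. The cut at \<open>t < 1\<close> is
  needed because \<open>phi\<close> has a singularity at \<open>1\<close>; it costs \<open>1 - S t\<close>, which is of second order in \<open>1 - t\<close>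
  as \<open>S\<close> has its maximum at \<open>1\<close>.
\<close>

lemma F_at_cos_node_truncated:
  fixes t :: real and k :: nat
  defines "x \<equiv> cos_node k"
  assumes t: "0 \<le> t" "t < 1"
  shows "2 / x * (phi 0 - phi t * (x\<^sup>2 * (1 - t)\<^sup>2 / 2))
     \<le> (-1) ^ k * integral {0..t} (\<lambda>s. phi s * (s powr (-1/2) * cos (x * sqrt s)))"
proof -
  let ?f = "\<lambda>s. s powr (-1/2) * cos (x * sqrt s)"
  have x: "x > 0" by (simp add: x_def cos_node_pos)
  define S where "S s = (-1) ^ k * sin (x * sqrt s)" for s
  have int: "integral {d..e} ?f = 2 / x * (sin (x * sqrt e) - sin (x * sqrt d))" if "0 \<le> d" "d \<le> e" for d e
    using cos_sqrt_kernel_integral[OF x that] by (rule integral_unique)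
  have "?f integrable_on {0..t}"
    using cos_sqrt_kernel_integral[OF x order_refl t(1)] by blast
  then obtain a where a: "a \<in> {0..t}"
      and mvt: "integral {0..t} (\<lambda>s. phi s * ?f s) = phi 0 * integral {0..a} ?f + phi t * integral {a..t} ?f"
  proof (rule second_mean_value_theorem)
    show "phi u \<le> phi v" if "0 \<le> u" "u \<le> v" "v \<le> t" for u v
      using phi_mono that t by simp
  qed (use t in auto)
  have eq: "(-1) ^ k * integral {0..t} (\<lambda>s. phi s * ?f s)
      = 2 / x * (phi 0 * S a + phi t * (S t - S a))"
  proof -
    have 1: "integral {0..a} ?f = 2 / x * sin (x * sqrt a)" using int[of 0 a] a by simp
    have 2: "integral {a..t} ?f = 2 / x * (sin (x * sqrt t) - sin (x * sqrt a))"
      using int[of a t] a by simp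
    show ?thesis unfolding mvt 1 2 by (simp add: S_def algebra_simps)
  qed
  have Sa: "S a \<le> 1"
    using sin_le_one[of "x * sqrt a"] sin_ge_minus_one[of "x * sqrt a"]
    unfolding S_def by (cases "even k") simp_all
  have St: "1 - S t \<le> x\<^sup>2 * (1 - t)\<^sup>2 / 2"
  proof -
    have "S t = cos (x * (1 - sqrt t))"
    proof -
      have "cos (x * (1 - sqrt t)) = cos x * cos (x * sqrt t) + sin x * sin (x * sqrt t)"
        by (simp add: right_diff_distrib cos_diff)
      then show ?thesis by (simp add: S_def x_def)
    qed
    moreover have "1 - (x * (1 - sqrt t))\<^sup>2 / 2 \<le> cos (x * (1 - sqrt t))"
      by (rule one_minus_half_square_le_cos)
    moreover have "(x * (1 - sqrt t))\<^sup>2 \<le> (x * (1 - t))\<^sup>2"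
    proof -
      have "t \<le> sqrt t" using t by (intro real_le_rsqrt) (simp add: power2_eq_square mult_left_le)
      moreover have "sqrt t \<le> 1" using t by simp
      ultimately show ?thesis using x by (intro power_mono mult_left_mono) auto
    qed
    ultimately show ?thesis by (simp add: power_mult_distrib)
  qed
  have "phi 0 - phi t * (x\<^sup>2 * (1 - t)\<^sup>2 / 2) \<le> phi 0 - phi t * (1 - S t)"
    by (rule diff_left_mono[OF mult_left_mono[OF St phi_nonneg]])
  also have "\<dots> = phi t * S t - (phi t - phi 0) * 1" by (simp add: algebra_simps)
  also have "\<dots> \<le> phi t * S t - (phi t - phi 0) * S a"
    using mult_left_mono[OF Sa, of "phi t - phi 0"] phi_mono[of 0 t] t by simp
  also have "\<dots> = phi 0 * S a + phi t * (S t - S a)" by (simp add: algebra_simps)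
  finally show ?thesis unfolding eq using x by (intro mult_left_mono) auto
qed

text \<open>
  As \<open>t\<close> tends to \<open>1\<close>, the correction in the truncated estimate vanishes: \<open>phi t\<close> grows at most like
  \<open>(1 - t) powr (b + c - 5/2)\<close>, whose exponent exceeds \<open>-1\<close>. What is left is a positive multiple of \<open>phi 0\<close>.
\<close>

theorem F_alternates_at_cos_nodes:
  "(-1) ^ k * Re (F (of_real (- ((cos_node k)\<^sup>2) / 4))) > 0"
proof -
  define x where "x = cos_node k"
  have x: "x > 0" by (simp add: x_def cos_node_pos)
  let ?f = "\<lambda>s. phi s * (s powr (-1/2) * cos (x * sqrt s))"
  let ?J = "mass * Re (F (of_real (- (x\<^sup>2) / 4)))"
  have "?f integrable_on {0..1}" using density_cos_has_integral by blast
  then have "continuous_on {0..1} (\<lambda>t. integral {0..t} ?f)"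
    by (rule indefinite_integral_continuous_1)
  then have "((\<lambda>t. integral {0..t} ?f) \<longlongrightarrow> integral {0..1} ?f) (at 1 within {0..1})"
    by (simp add: continuous_on_def)
  then have "((\<lambda>t. integral {0..t} ?f) \<longlongrightarrow> ?J) (at_left 1)"
    using integral_unique[OF density_cos_has_integral[of x]] by (simp add: at_within_Icc_at_left)
  then have limR: "((\<lambda>t. (-1) ^ k * integral {0..t} ?f) \<longlongrightarrow> (-1) ^ k * ?J) (at_left 1)"
    by (intro tendsto_intros)
  have ev: "eventually (\<lambda>t::real. 0 < t \<and> t < 1) (at_left 1)"
    using eventually_at_left_real[of 0 "1::real"] by (rule eventually_mono) auto
  have "((\<lambda>t. phi t * (1 - t)\<^sup>2) \<longlongrightarrow> 0) (at_left 1)"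
  proof (rule Lim_null_comparison)
    show "eventually (\<lambda>t. norm (phi t * (1 - t)\<^sup>2) \<le> psi 1 * (1 - t)) (at_left 1)"
      using ev
    proof eventually_elim
      case (elim t)
      have "(1 - t) powr (b + c - 5/2) * (1 - t)\<^sup>2 = (1 - t) powr (b + c - 1/2)"
        using elim powr_add[of "1 - t" "b + c - 5/2" 2] by simp
      also have "\<dots> \<le> (1 - t) powr 1"
        using elim b c by (intro powr_mono') auto
      finally have "psi t * ((1 - t) powr (b + c - 5/2) * (1 - t)\<^sup>2) \<le> psi 1 * (1 - t)"
        using elim psi_mono[of t 1] psi_nonneg by (intro mult_mono) auto
      then show ?case by (simp add: phi_def abs_mult psi_nonneg mult_ac)
    qed
    have "((\<lambda>t. psi 1 * (1 - t)) \<longlongrightarrow> psi 1 * (1 - 1)) (at_left 1)" by (intro tendsto_intros)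
    then show "((\<lambda>t. psi 1 * (1 - t)) \<longlongrightarrow> 0) (at_left 1)" by simp
  qed
  then have "((\<lambda>t. 2 / x * (phi 0 - x\<^sup>2 / 2 * (phi t * (1 - t)\<^sup>2))) \<longlongrightarrow> 2 / x * (phi 0 - x\<^sup>2 / 2 * 0)) (at_left 1)"
    by (intro tendsto_intros)
  then have limL: "((\<lambda>t. 2 / x * (phi 0 - phi t * (x\<^sup>2 * (1 - t)\<^sup>2 / 2))) \<longlongrightarrow> 2 / x * phi 0) (at_left 1)"
    by (simp add: mult_ac)
  have "eventually (\<lambda>t. 2 / x * (phi 0 - phi t * (x\<^sup>2 * (1 - t)\<^sup>2 / 2)) \<le> (-1) ^ k * integral {0..t} ?f) (at_left 1)"
    using ev by eventually_elim (use F_at_cos_node_truncated[of _ k] in \<open>simp add: x_def\<close>)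
  from tendsto_le[OF _ limR limL this] have "2 / x * phi 0 \<le> (-1) ^ k * ?J" by simp
  moreover have "2 / x * phi 0 > 0" using x phi_0_pos by simp
  ultimately have "mass * ((-1) ^ k * Re (F (of_real (- (x\<^sup>2) / 4)))) > 0"
    by (simp only: mult.left_commute)
  then show ?thesis using mass_pos by (simp add: zero_less_mult_iff x_def)
qed

section \<open>Zeros of the hypergeometric function\<close>

sublocale E: cos_interlaced "\<lambda>w. F (- w / 4)" 1
proof
  show "(\<lambda>w. F (- w / 4)) holomorphic_on UNIV"
  proof -
    have "(\<lambda>w::complex. - w / 4) holomorphic_on UNIV" by (intro holomorphic_intros) auto
    from holomorphic_on_compose[OF this F_holomorphic] show ?thesis by (simp add: o_def)
  qed
  show "norm (F (- (z\<^sup>2) / 4)) \<le> 1 * exp \<bar>Im z\<bar>" for z using F_dominated[of z] by simp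
  have eq: "- complex_of_real r / 4 = of_real (- r / 4)" for r by simp
  show "F (- complex_of_real r / 4) \<in> \<real>" for r unfolding eq by (rule F_real)
  show "0 < (-1) ^ k * Re (F (- complex_of_real ((cos_node k)\<^sup>2) / 4))" for k
    unfolding eq by (rule F_alternates_at_cos_nodes)
  show "0 < Re (F (- complex_of_real r / 4))" if "r \<le> 0" for r
    unfolding eq using that by (intro F_pos) auto
qed

theorem F_zeros:
  defines "I \<equiv> \<lambda>k::nat. {- ((2 * real k + 3)\<^sup>2 * pi\<^sup>2 / 16) <..< - ((2 * real k + 1)\<^sup>2 * pi\<^sup>2 / 16)}"
  shows "F holomorphic_on UNIV \<and>
            (\<forall>z. F z = 0 \<longrightarrow> z \<in> \<real> \<and> Re z < 0) \<and>
            (\<forall>z. F z = 0 \<longrightarrow> zorder F z = 1) \<and>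
            (\<forall>z. F z = 0 \<longrightarrow> (\<exists>k. z \<in> of_real ` I k)) \<and>
            (\<forall>k. \<exists>!z. z \<in> of_real ` I k \<and> F z = 0)"
proof -
  have gap: "- r / 4 \<in> I k \<longleftrightarrow> (cos_node k)\<^sup>2 < r \<and> r < (cos_node (Suc k))\<^sup>2" for r k
    by (auto simp: I_def cos_node_def power2_eq_square field_simps)
  have I: "\<exists>k r. z = of_real (- r / 4) \<and> - r / 4 \<in> I k" if "F z = 0" for z
  proof -
    have "F (- (- 4 * z) / 4) = 0" using that by simp
    then obtain k r where kr: "- 4 * z = of_real r" "(cos_node k)\<^sup>2 < r" "r < (cos_node (Suc k))\<^sup>2"
      using E.zero_in_gap by blast
    have "z = - (- 4 * z) / 4" by simp
    also have "\<dots> = of_real (- r / 4)" unfolding kr(1) by simp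
    finally show ?thesis using kr gap by blast
  qed
  have neg: "x < 0" if "x \<in> I k" for x k
  proof -
    have "(2 * real k + 1)\<^sup>2 * pi\<^sup>2 / 16 > 0" by (simp add: add_nonneg_pos)
    then show ?thesis using that unfolding I_def greaterThanLessThan_iff by linarith
  qed
  have 1: "z \<in> \<real> \<and> Re z < 0" if "F z = 0" for z
    using I[OF that] neg by fastforce
  have 2: "zorder F z = 1" if "F z = 0" for z
  proof (rule zorder_zero_eqI[OF F_holomorphic open_UNIV])
    have "((\<lambda>w. F (- w / 4)) has_field_derivative deriv F z * (- 1 / 4)) (at (- 4 * z))"
    proof (rule DERIV_chain'[where f = "\<lambda>w. - w / 4"])
      show "((\<lambda>w::complex. - w / 4) has_field_derivative - 1 / 4) (at (- 4 * z))"
        by (auto intro!: derivative_eq_intros)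
      show "(F has_field_derivative deriv F z) (at (- (- 4 * z) / 4))"
        using holomorphic_derivI[OF F_holomorphic open_UNIV, of z] by simp
    qed
    then have "deriv (\<lambda>w. F (- w / 4)) (- 4 * z) = deriv F z * (- 1 / 4)" by (rule DERIV_imp_deriv)
    moreover have "deriv (\<lambda>w. F (- w / 4)) (- 4 * z) \<noteq> 0" using that by (intro E.zero_simple) simp
    ultimately show "(deriv ^^ nat 1) F z \<noteq> 0" by auto
  qed (use that in auto)
  have 3: "\<exists>k. z \<in> of_real ` I k" if "F z = 0" for z
    using I[OF that] by blast
  have 4: "\<exists>!z. z \<in> of_real ` I k \<and> F z = 0" for k
  proof -
    have eq: "- complex_of_real r / 4 = of_real (- r / 4)" for r by simp
    obtain r where r: "(cos_node k)\<^sup>2 < r" "r < (cos_node (Suc k))\<^sup>2" "F (- of_real r / 4) = 0"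
      using E.gap_zero_exists .
    show ?thesis
    proof (rule ex1I[of _ "of_real (- r / 4)"])
      show "of_real (- r / 4) \<in> complex_of_real ` I k \<and> F (of_real (- r / 4)) = 0"
        using r gap unfolding eq by blast
      fix z assume "z \<in> complex_of_real ` I k \<and> F z = 0"
      then obtain y where y: "z = of_real y" "y \<in> I k" "F (of_real y) = 0" by blast
      then have "- (- 4 * y) / 4 \<in> I k" by simp
      then have "- 4 * y = r"
        using E.gap_zero_unique[of k "- 4 * y" r] r y(3) gap[of "- 4 * y" k] by simp
      then show "z = of_real (- r / 4)" using y by auto
    qed
  qed
  show ?thesis using F_holomorphic 1 2 3 4 by blast
qed

end

lemma hypergeometric_1F2_commute: "hypergeometric_1F2 a b c = hypergeometric_1F2 a c b"
  by (simp add: fun_eq_iff hypergeometric_1F2_series mult.commute)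

theorem corollary4p3:
  fixes \<mu> \<nu> :: real
  assumes "\<mu> \<in> {-3/2 <..< -1/2}"
    and "\<bar>\<nu>\<bar> \<in> {\<bar>\<mu> + 1\<bar> <..< \<mu> + 2}"
  shows "let F = hypergeometric_1F2 1 (of_real ((\<mu> - \<nu> + 3) / 2)) (of_real ((\<mu> + \<nu> + 3) / 2));
             I = (\<lambda>k::nat. {- ((2 * real k + 3)\<^sup>2 * pi\<^sup>2 / 16) <..< - ((2 * real k + 1)\<^sup>2 * pi\<^sup>2 / 16)})
         in F holomorphic_on UNIV \<and>
            (\<forall>z. F z = 0 \<longrightarrow> z \<in> \<real> \<and> Re z < 0) \<and>
            (\<forall>z. F z = 0 \<longrightarrow> zorder F z = 1) \<and>
            (\<forall>z. F z = 0 \<longrightarrow> (\<exists>k. z \<in> of_real ` I k)) \<and>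
            (\<forall>k. \<exists>!z. z \<in> of_real ` I k \<and> F z = 0)"
proof -
  interpret cosine_params "(\<mu> - \<bar>\<nu>\<bar> + 3) / 2" "(\<mu> + \<bar>\<nu>\<bar> + 3) / 2"
    using assms by unfold_locales (auto simp: abs_less_iff add_divide_distrib diff_divide_distrib)
  have eq: "hypergeometric_1F2 1 (of_real ((\<mu> - \<nu> + 3) / 2)) (of_real ((\<mu> + \<nu> + 3) / 2)) = F"
  proof (cases "\<nu> \<ge> 0")
    case False
    then show ?thesis by simp (rule hypergeometric_1F2_commute)
  qed simp
  show ?thesis unfolding Let_def eq by (rule F_zeros)
qed

end
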